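(* Let $(R,\mathfrak m)$ be a $2$-dimensional Cohen-Macaulay local ring. Let $\mathcal F=\{I_n\}_{n\ge0}$ be a Hilbert filtration of $R$ and let $K$ be an ideal of $R$ such that $I_{n+1}\subseteq KI_n$ for all $n\ge0$. Let $J=(x,y)$ be a minimal reduction of $I_1$. Then $\lambda(R/rr_K(I_n))$ coincides with the polynomial $P_K(\mathcal F,n)$ for $n\gg0$, and the following hold. 1. For $n\ge2$, $$\Delta^2\big[P_K(\mathcal F,n)-\lambda(R/rr_K(I_n))\big]=\lambda\left(\frac{rr_K(I_n)}{J\,rr_K(I_{n-1})}\right).$$ 2. Set $$v_n=\begin{cases} e_0(\mathcal F)-\lambda(R/rr_K(I_0)) & \text{if } n=0,\\ e_0(\mathcal F)-\lambda(R/rr_K(I_1))+2\lambda(R/rr_K(I_0)) & \text{if } n=1,\\ \lambda\big(rr_K(I_n)/J\,rr_K(I_{n-1})\big) & \text{if } n\ge2.\end{cases}$$ Then $$g_1=\sum_{n\ge1}v_n-\lambda(R/rr_K(I_0))\qquad\text{and}\qquad g_2=\sum_{n\ge1}(n-1)v_n-\lambda(R/rr_K(I_0)).$$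
   Context: $\lambda$ denotes length of $R$-modules. A Hilbert filtration ($I_1$-good filtration) is a decreasing sequence of ideals $\mathcal F=\{I_n\}_{n\ge0}$ with $I_0=R$ such that $I_nI_m\subseteq I_{n+m}$ for all $n,m\ge0$; there is $p\ge0$ with $I_1I_n=I_{n+1}$ for all $n\ge p$; and $I_1$ is $\mathfrak m$-primary. The Ratliff-Rush closure of $\mathcal F$ with respect to $K$ is given by $rr_K(I_n)=\bigcup_{k\ge1}(KI_{n+k}:I_1^k)$, $n\ge 0$. In dimension $2$, for $n\gg0$, $\lambda(R/I_n)$ agrees with a polynomial $e_0(\mathcal F)\binom{n+1}{2}-e_1(\mathcal F)n+e_2(\mathcal F)$, and $\lambda(R/KI_n)$ agrees with a polynomial $P_K(\mathcal F,n)=g_0\binom{n+1}{2}-g_1n+g_2$; this defines $e_i(\mathcal F)$ and $g_i$. $\Delta$ is the backward difference, so $\Delta^2 f(n)=f(n)-2f(n-1)+f(n-2)$.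
   Formalization: In the formula for g_2 the last term is corrected to +λ(R/rr_K(I_0)); the printed minus sign fails, e.g. for R=k[[x,y]], K=m, I_n=m^n, J=m, where g_2=1, all v_n=0 and λ(R/rr_K(I_0))=1. *)

theory Defs
  imports "HOL-Algebra.Module" "HOL-Algebra.Ring_Divisibility" "HOL-Algebra.Ideal_Product"
    "HOL-Library.Extended_Nat"
begin

section \<open>Length of modules\<close>

definition ideal_module :: "('a, 'b) ring_scheme \<Rightarrow> 'a set \<Rightarrow> ('a, 'a) module" where
  "ideal_module R A =
     \<lparr>carrier = A, monoid.mult = monoid.mult R, one = one R, zero = zero R, add = add R,
      smult = monoid.mult R\<rparr>"

text \<open>The record type of modules extends that of rings; its fields \<open>mult\<close> and \<open>one\<close> play no role
  for modules and are left unspecified.\<close>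

definition quot_module :: "('a, 'c, 'd) module_scheme \<Rightarrow> 'c set \<Rightarrow> ('a, 'c set) module" where
  "quot_module M N =
     \<lparr>carrier = a_rcosets\<^bsub>M\<^esub> N, monoid.mult = undefined, one = undefined, zero = N,
      add = set_add M, smult = (\<lambda>r X. \<Union>x\<in>X. N +>\<^bsub>M\<^esub> (r \<odot>\<^bsub>M\<^esub> x))\<rparr>"

definition module_length :: "('a, 'b) ring_scheme \<Rightarrow> ('a, 'c, 'd) module_scheme \<Rightarrow> enat" where
  "module_length R M =
     Sup {enat l | l. \<exists>C :: nat \<Rightarrow> 'c set.
            (\<forall>i\<le>l. submodule (C i) R M) \<and> (\<forall>i<l. C i \<subset> C (Suc i))}"

definition quot_length :: "('a, 'b) ring_scheme \<Rightarrow> 'a set \<Rightarrow> 'a set \<Rightarrow> enat" where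
  "quot_length R A B = module_length R (quot_module (ideal_module R A) B)"

text \<open>The integer \<open>\<lambda>(A/B)\<close>; it is meaningful only if \<open>quot_length R A B \<noteq> \<infinity>\<close>.\<close>

definition len :: "('a, 'b) ring_scheme \<Rightarrow> 'a set \<Rightarrow> 'a set \<Rightarrow> int" where
  "len R A B = int (the_enat (quot_length R A B))"


section \<open>Cohen--Macaulay local rings\<close>

definition noetherian_local_ring :: "('a, 'b) ring_scheme \<Rightarrow> 'a set \<Rightarrow> bool" where
  "noetherian_local_ring R m \<longleftrightarrow>
     cring R \<and> noetherian_ring R \<and> maximalideal m R \<and> (\<forall>m'. maximalideal m' R \<longrightarrow> m' = m)"

definition krull_dim :: "('a, 'b) ring_scheme \<Rightarrow> enat" where
  "krull_dim R =
     Sup {enat l | l. \<exists>P :: nat \<Rightarrow> 'a set.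
            (\<forall>i\<le>l. primeideal (P i) R) \<and> (\<forall>i<l. P i \<subset> P (Suc i))}"

definition regular_sequence :: "('a, 'b) ring_scheme \<Rightarrow> 'a list \<Rightarrow> bool" where
  "regular_sequence R xs \<longleftrightarrow>
     set xs \<subseteq> carrier R \<and> Idl\<^bsub>R\<^esub> (set xs) \<noteq> carrier R \<and>
     (\<forall>i<length xs. \<forall>a\<in>carrier R.
        a \<otimes>\<^bsub>R\<^esub> xs ! i \<in> Idl\<^bsub>R\<^esub> (set (take i xs)) \<longrightarrow> a \<in> Idl\<^bsub>R\<^esub> (set (take i xs)))"

definition ring_depth :: "('a, 'b) ring_scheme \<Rightarrow> 'a set \<Rightarrow> enat" where
  "ring_depth R m = Sup {enat (length xs) | xs. set xs \<subseteq> m \<and> regular_sequence R xs}"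

definition cohen_macaulay_local_ring :: "('a, 'b) ring_scheme \<Rightarrow> 'a set \<Rightarrow> bool" where
  "cohen_macaulay_local_ring R m \<longleftrightarrow>
     noetherian_local_ring R m \<and> ring_depth R m = krull_dim R"


section \<open>Ideals and filtrations\<close>

abbreviation ideal_pow :: "('a, 'b) ring_scheme \<Rightarrow> 'a set \<Rightarrow> nat \<Rightarrow> 'a set" where
  "ideal_pow R I k \<equiv> I [^]\<^bsub>ideals_set R\<^esub> k"

definition colon :: "('a, 'b) ring_scheme \<Rightarrow> 'a set \<Rightarrow> 'a set \<Rightarrow> 'a set" where
  "colon R A B = {r \<in> carrier R. \<forall>b\<in>B. r \<otimes>\<^bsub>R\<^esub> b \<in> A}"

definition radical :: "('a, 'b) ring_scheme \<Rightarrow> 'a set \<Rightarrow> 'a set" where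
  "radical R I = {a \<in> carrier R. \<exists>k::nat. a [^]\<^bsub>R\<^esub> k \<in> I}"

definition primary_ideal :: "('a, 'b) ring_scheme \<Rightarrow> 'a set \<Rightarrow> bool" where
  "primary_ideal R Q \<longleftrightarrow>
     ideal Q R \<and> Q \<noteq> carrier R \<and>
     (\<forall>a\<in>carrier R. \<forall>b\<in>carrier R. a \<otimes>\<^bsub>R\<^esub> b \<in> Q \<longrightarrow> a \<in> Q \<or> b \<in> radical R Q)"

definition primary_to :: "('a, 'b) ring_scheme \<Rightarrow> 'a set \<Rightarrow> 'a set \<Rightarrow> bool" where
  "primary_to R m Q \<longleftrightarrow> primary_ideal R Q \<and> radical R Q = m"

definition reduction :: "('a, 'b) ring_scheme \<Rightarrow> 'a set \<Rightarrow> 'a set \<Rightarrow> bool" where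
  "reduction R J I \<longleftrightarrow>
     ideal J R \<and> J \<subseteq> I \<and> (\<exists>k. J \<cdot>\<^bsub>R\<^esub> ideal_pow R I k = ideal_pow R I (Suc k))"

definition minimal_reduction :: "('a, 'b) ring_scheme \<Rightarrow> 'a set \<Rightarrow> 'a set \<Rightarrow> bool" where
  "minimal_reduction R J I \<longleftrightarrow>
     reduction R J I \<and> (\<forall>J'. reduction R J' I \<and> J' \<subseteq> J \<longrightarrow> J' = J)"

definition hilbert_filtration :: "('a, 'b) ring_scheme \<Rightarrow> 'a set \<Rightarrow> (nat \<Rightarrow> 'a set) \<Rightarrow> bool" where
  "hilbert_filtration R m F \<longleftrightarrow>
     (\<forall>n. ideal (F n) R) \<and> F 0 = carrier R \<and> (\<forall>n. F (Suc n) \<subseteq> F n) \<and>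
     (\<forall>n k. F n \<cdot>\<^bsub>R\<^esub> F k \<subseteq> F (n + k)) \<and>
     (\<exists>p. \<forall>n\<ge>p. F 1 \<cdot>\<^bsub>R\<^esub> F n = F (Suc n)) \<and>
     primary_to R m (F 1)"

definition rr :: "('a, 'b) ring_scheme \<Rightarrow> 'a set \<Rightarrow> (nat \<Rightarrow> 'a set) \<Rightarrow> nat \<Rightarrow> 'a set" where
  "rr R K F n = (\<Union>k\<in>{1..}. colon R (K \<cdot>\<^bsub>R\<^esub> F (n + k)) (ideal_pow R (F 1) k))"


section \<open>Hilbert coefficients in dimension two\<close>

definition poly2 :: "int \<times> int \<times> int \<Rightarrow> nat \<Rightarrow> int" where
  "poly2 c n = (case c of (c0, c1, c2) \<Rightarrow> c0 * int ((n + 1) choose 2) - c1 * int n + c2)"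

text \<open>Two polynomials that agree for all large \<open>n\<close> are equal, so there is at most one such
  triple; in dimension two there is one.\<close>

definition poly2_coeffs :: "(nat \<Rightarrow> int) \<Rightarrow> int \<times> int \<times> int" where
  "poly2_coeffs f = (THE c. \<forall>\<^sub>F n in sequentially. f n = poly2 c n)"

definition hilbert_coeffs ::
  "('a, 'b) ring_scheme \<Rightarrow> (nat \<Rightarrow> 'a set) \<Rightarrow> int \<times> int \<times> int" where
  "hilbert_coeffs R F = poly2_coeffs (\<lambda>n. len R (carrier R) (F n))"

definition fiber_coeffs ::
  "('a, 'b) ring_scheme \<Rightarrow> 'a set \<Rightarrow> (nat \<Rightarrow> 'a set) \<Rightarrow> int \<times> int \<times> int" where
  "fiber_coeffs R K F = poly2_coeffs (\<lambda>n. len R (carrier R) (K \<cdot>\<^bsub>R\<^esub> F n))"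

text \<open>Because of truncated subtraction on \<open>nat\<close>, the \<open>j\<close>-th iterate is the usual difference only
  for \<open>n \<ge> j\<close>.\<close>

definition backward_diff :: "(nat \<Rightarrow> int) \<Rightarrow> nat \<Rightarrow> int" where
  "backward_diff f n = f n - f (n - 1)"

definition vseq ::
  "('a, 'b) ring_scheme \<Rightarrow> 'a set \<Rightarrow> (nat \<Rightarrow> 'a set) \<Rightarrow> 'a set \<Rightarrow> nat \<Rightarrow> int" where
  "vseq R K F J n =
     (let (e0, e1, e2) = hilbert_coeffs R F; h = (\<lambda>i. len R (carrier R) (rr R K F i)) in
      if n = 0 then e0 - h 0
      else if n = 1 then e0 - h 1 + 2 * h 0
      else len R (rr R K F n) (J \<cdot>\<^bsub>R\<^esub> rr R K F (n - 1)))"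

end

theory Submission
  imports Defs
begin

text \<open>Only exactness of the Koszul complex of \<open>x, y\<close> in the middle degree is needed; it follows from
  depth two, as \<open>J\<close> contains powers of a regular sequence. For an ideal \<open>L\<close> of finite colength it gives
  \<open>\<lambda>(J/JL) + \<lambda>(R/(L : J)) = 2 \<lambda>(R/L)\<close>, which for \<open>L = rr\<^sub>K(I\<^sub>n\<^sub>-\<^sub>1)\<close> is the formula for the second
  difference because \<open>(rr\<^sub>K(I\<^sub>n) : J) = rr\<^sub>K(I\<^sub>n\<^sub>-\<^sub>1)\<close>. For \<open>L = K I\<^sub>n\<close> it shows that the second difference
  of \<open>\<lambda>(R/K I\<^sub>n)\<close> is eventually at least \<open>\<lambda>(R/J)\<close>, with equality iff \<open>(K I\<^sub>n\<^sub>+\<^sub>1 : J) = K I\<^sub>n\<close>. Since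
  \<open>\<lambda>(R/J\<^sup>n)\<close> bounds the growth, equality holds for large \<open>n\<close>; hence \<open>rr\<^sub>K(I\<^sub>n) = K I\<^sub>n\<close> for large \<open>n\<close>
  and the Hilbert polynomials exist with leading coefficient \<open>\<lambda>(R/J)\<close>. The formulas for \<open>g\<^sub>1\<close> and
  \<open>g\<^sub>2\<close> follow by summation by parts.\<close>

section \<open>Length\<close>

text \<open>Every length in the argument belongs to a quotient A/B of two ideals, so it is measured
  by chains of ideals between B and A, and isomorphisms of modules become order isomorphisms of such
  families. Apart from the passage to chains, a single isomorphism is used: multiplication by a ring
  element a identifies (Aa + B)/B with A/{r \<in> A. ra \<in> B}. The Koszul formula, the bound on
  \<lambda>(R/J^n) and the finiteness of \<lambda>(R/J) are all assembled from it by additivity.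
  These identities are stated as sums in \<open>enat\<close>, since finiteness is itself something
  to be derived, and pass to \<open>int\<close> afterwards. The growth bound forces equality only
  because lengths are integers: a nonnegative integer sequence whose slope never increases has
  eventually constant slope.\<close>

definition chain_length :: "'a set set \<Rightarrow> enat" where
  "chain_length S =
     Sup {enat l | l. \<exists>C :: nat \<Rightarrow> 'a set. (\<forall>i\<le>l. C i \<in> S) \<and> (\<forall>i<l. C i \<subset> C (Suc i))}"

text \<open>By the correspondence theorem these are the submodules of A/B. Keeping them inside R
  allows sums, intersections and preimages of ideals to be used directly.\<close>

definition ideals_between :: "('a, 'b) ring_scheme \<Rightarrow> 'a set \<Rightarrow> 'a set \<Rightarrow> 'a set set" where
  "ideals_between R B A = {C. ideal C R \<and> B \<subseteq> C \<and> C \<subseteq> A}"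

lemma chain_length_upper:
  assumes "\<And>i. i \<le> l \<Longrightarrow> C i \<in> S" "\<And>i. i < l \<Longrightarrow> C i \<subset> C (Suc i)"
  shows "enat l \<le> chain_length S"
  unfolding chain_length_def using assms by (intro Sup_upper) blast

lemma chain_length_least:
  assumes "\<And>l C. \<lbrakk>\<And>i. i \<le> l \<Longrightarrow> C i \<in> S; \<And>i. i < l \<Longrightarrow> C i \<subset> C (Suc i)\<rbrakk> \<Longrightarrow> enat l \<le> n"
  shows "chain_length S \<le> n"
  unfolding chain_length_def using assms by (intro Sup_least) blast

lemma chain_length_le_map:
  assumes "\<And>X. X \<in> S \<Longrightarrow> f X \<in> T"
    and "\<And>X Y. \<lbrakk>X \<in> S; Y \<in> S; X \<subset> Y\<rbrakk> \<Longrightarrow> f X \<subset> f Y"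
  shows "chain_length S \<le> chain_length T"
proof (rule chain_length_least)
  fix l and C :: "nat \<Rightarrow> 'a set"
  assume C: "\<And>i. i \<le> l \<Longrightarrow> C i \<in> S" "\<And>i. i < l \<Longrightarrow> C i \<subset> C (Suc i)"
  show "enat l \<le> chain_length T"
    by (rule chain_length_upper[of l "\<lambda>i. f (C i)"]) (simp add: assms(1) C(1), simp add: assms(2) C)
qed

lemma chain_length_eq_iso:
  assumes "\<And>X. X \<in> S \<Longrightarrow> f X \<in> T \<and> g (f X) = X"
    and "\<And>Y. Y \<in> T \<Longrightarrow> g Y \<in> S \<and> f (g Y) = Y"
    and "\<And>X X'. \<lbrakk>X \<in> S; X' \<in> S; X \<subseteq> X'\<rbrakk> \<Longrightarrow> f X \<subseteq> f X'"
    and "\<And>Y Y'. \<lbrakk>Y \<in> T; Y' \<in> T; Y \<subseteq> Y'\<rbrakk> \<Longrightarrow> g Y \<subseteq> g Y'"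
  shows "chain_length S = chain_length T"
proof (rule antisym)
  show "chain_length S \<le> chain_length T"
    by (rule chain_length_le_map[of _ f]) (use assms(1,3) in \<open>auto simp: psubset_eq, metis\<close>)
  show "chain_length T \<le> chain_length S"
    by (rule chain_length_le_map[of _ g]) (use assms(2,4) in \<open>auto simp: psubset_eq, metis\<close>)
qed

text \<open>Repetitions are deleted and the jumps counted. Intersecting a strict chain with a fixed
  ideal, or adding an ideal to it, produces only a weak chain of this kind.\<close>

lemma chain_length_weak_chain:
  assumes "\<And>i. i \<le> l \<Longrightarrow> C i \<in> S" "\<And>i. i < l \<Longrightarrow> C i \<subseteq> C (Suc i)"
  shows "enat (card {i. i < l \<and> C i \<noteq> C (Suc i)}) \<le> chain_length S"
proof -
  \<comment> \<open>The claim also records the last member of the thinned chain, because the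
    induction appends \<open>C (Suc l)\<close> there.\<close>
  have "\<exists>D. (\<forall>i\<le>card {i. i < l \<and> C i \<noteq> C (Suc i)}. D i \<in> S) \<and>
            (\<forall>i<card {i. i < l \<and> C i \<noteq> C (Suc i)}. D i \<subset> D (Suc i)) \<and>
            D (card {i. i < l \<and> C i \<noteq> C (Suc i)}) = C l"
    using assms
  proof (induction l)
    case 0
    then show ?case by (intro exI[of _ C]) auto
  next
    case (Suc l)
    define k where "k = card {i. i < l \<and> C i \<noteq> C (Suc i)}"
    obtain D where D: "\<forall>i\<le>k. D i \<in> S" "\<forall>i<k. D i \<subset> D (Suc i)" "D k = C l"
      using Suc.IH[OF Suc.prems] unfolding k_def by fastforce
    show ?case
    proof (cases "C l = C (Suc l)")
      case True
      then have "{i. i < Suc l \<and> C i \<noteq> C (Suc i)} = {i. i < l \<and> C i \<noteq> C (Suc i)}"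
        by (auto simp: less_Suc_eq)
      then have card: "card {i. i < Suc l \<and> C i \<noteq> C (Suc i)} = k"
        unfolding k_def by simp
      show ?thesis unfolding card using D True by blast
    next
      case False
      then have "{i. i < Suc l \<and> C i \<noteq> C (Suc i)} = insert l {i. i < l \<and> C i \<noteq> C (Suc i)}"
        by (auto simp: less_Suc_eq)
      then have card: "card {i. i < Suc l \<and> C i \<noteq> C (Suc i)} = Suc k"
        unfolding k_def by simp
      have "C l \<subset> C (Suc l)" using Suc.prems(2)[of l] False by auto
      then show ?thesis
        unfolding card using D Suc.prems(1)[of "Suc l"]
        by (intro exI[of _ "D(Suc k := C (Suc l))"]) (auto simp: le_Suc_eq less_Suc_eq)
    qed
  qed
  then obtain D where
    "\<forall>i\<le>card {i. i < l \<and> C i \<noteq> C (Suc i)}. D i \<in> S"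
    "\<forall>i<card {i. i < l \<and> C i \<noteq> C (Suc i)}. D i \<subset> D (Suc i)"
    by blast
  then show ?thesis by (intro chain_length_upper) blast+
qed

text \<open>Either supremum may be infinite, so longest chains cannot simply be chosen. One supremum
  is taken at a time: a chain in \<open>S\<close> is fixed while those in \<open>T\<close> vary, and
  only then does the chain in \<open>S\<close> vary.\<close>

lemma chain_length_append:
  assumes "S \<noteq> {}" "T \<noteq> {}" "S \<subseteq> U" "T \<subseteq> U" "\<And>X Y. X \<in> S \<Longrightarrow> Y \<in> T \<Longrightarrow> X \<subseteq> Y"
  shows "chain_length S + chain_length T \<le> chain_length U"
proof -
  have 1: "enat l + enat k \<le> chain_length U"
    if C: "\<forall>i\<le>l. C i \<in> S" "\<forall>i<l. C i \<subset> C (Suc i)"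
      and D: "\<forall>i\<le>k. D i \<in> T" "\<forall>i<k. D i \<subset> D (Suc i)" for l k C D
  proof -
    \<comment> \<open>\<open>D 0\<close> is dropped, since \<open>C l\<close> may equal it;
      \<open>C l \<subseteq> D 0 \<subset> D 1\<close> keeps the junction strict.\<close>
    let ?E = "\<lambda>i. if i \<le> l then C i else D (i - l)"
    have "enat (l + k) \<le> chain_length U"
    proof (rule chain_length_upper[of _ ?E])
      show "?E i \<in> U" if "i \<le> l + k" for i using that C D assms by (auto simp: subset_iff)
      show "?E i \<subset> ?E (Suc i)" if i: "i < l + k" for i
      proof (cases i l rule: linorder_cases)
        case less then show ?thesis using C by auto
      next
        case equal
        then have "D 0 \<subset> D (Suc 0)" using D i by auto
        moreover have "C l \<subseteq> D 0" using assms(5) C D by auto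
        ultimately show ?thesis using equal by auto
      next
        case greater
        then have "Suc i - l = Suc (i - l)" "i - l < k" using i by auto
        then show ?thesis using D greater by auto
      qed
    qed
    then show ?thesis by simp
  qed
  have 2: "enat l + chain_length T \<le> chain_length U"
    if "\<forall>i\<le>l. C i \<in> S" "\<forall>i<l. C i \<subset> C (Suc i)" for l C
  proof (cases "chain_length U")
    case (enat u)
    have "chain_length T \<le> enat (u - l)"
    proof (rule chain_length_least)
      fix k D assume "\<And>i. i \<le> k \<Longrightarrow> D i \<in> T" "\<And>i. i < k \<Longrightarrow> D i \<subset> D (Suc i)"
      then have "enat l + enat k \<le> chain_length U" using 1 that by blast
      then show "enat k \<le> enat (u - l)" using enat by simp
    qed
    \<comment> \<open>A one-element chain in \<open>T\<close> yields \<open>l \<le> u\<close>, which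
      makes the truncated difference \<open>u - l\<close> a true one.\<close>
    moreover obtain D where "\<forall>i\<le>(0::nat). D i \<in> T" "\<forall>i<(0::nat). D i \<subset> D (Suc i)"
      using assms(2) by auto
    then have "enat l + enat 0 \<le> chain_length U" using 1[of l C 0 D] that by blast
    then have "l \<le> u" using enat by simp
    ultimately show ?thesis using enat
      by (cases "chain_length T") auto
  qed simp
  show ?thesis
  proof (cases "chain_length U")
    case (enat u)
    obtain C where "\<forall>i\<le>(0::nat). C i \<in> S" "\<forall>i<(0::nat). C i \<subset> C (Suc i)"
      using assms(1) by auto
    then have "enat 0 + chain_length T \<le> enat u" using 2 enat by metis
    then obtain t where t: "chain_length T = enat t" "t \<le> u" by (cases "chain_length T") auto
    have "chain_length S \<le> enat (u - t)"
    proof (rule chain_length_least)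
      fix l C assume "\<And>i. i \<le> l \<Longrightarrow> C i \<in> S" "\<And>i. i < l \<Longrightarrow> C i \<subset> C (Suc i)"
      then have "enat l + enat t \<le> enat u" using 2 t enat by metis
      then show "enat l \<le> enat (u - t)" by simp
    qed
    then show ?thesis using t enat by (cases "chain_length S") auto
  qed simp
qed

section \<open>Lengths of quotients of ideals\<close>

context cring
begin

lemma
  assumes "ideal B R"
  shows a_rcos_eq_iff: "\<lbrakk>a \<in> carrier R; b \<in> carrier R\<rbrakk> \<Longrightarrow> B +> a = B +> b \<longleftrightarrow> a \<ominus> b \<in> B"
    and a_rcos_eq_self: "a \<in> carrier R \<Longrightarrow> B +> a = B \<longleftrightarrow> a \<in> B"
proof -
  interpret B: ideal B R by fact
  show *: "B +> a = B +> b \<longleftrightarrow> a \<ominus> b \<in> B" if "a \<in> carrier R" "b \<in> carrier R" for a b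
    using quotient_eq_iff_same_a_r_cos[OF assms that] by simp
  show "B +> a = B \<longleftrightarrow> a \<in> B" if "a \<in> carrier R"
    using *[OF that zero_closed] that a_coset_add_zero[OF B.a_subset] by (simp add: a_minus_def)
qed

text \<open>The correspondence theorem: an ideal goes to its set of cosets, and a submodule goes
  back to the elements of \<open>A\<close> whose cosets it contains. The locale
  \<open>submodule\<close> asks only for closure properties, so these are checked on cosets without
  first making the quotient a module.\<close>

lemma quot_length_eq_chain_length:
  assumes A: "ideal A R" and B: "ideal B R" and BA: "B \<subseteq> A"
  shows "quot_length R A B = chain_length (ideals_between R B A)"
proof -
  interpret A: ideal A R by fact
  interpret B: ideal B R by fact
  let ?M = "quot_module (ideal_module R A) B"
  let ?f = "\<lambda>S. {a \<in> A. B +> a \<in> S}" and ?g = "\<lambda>C. (\<lambda>c. B +> c) ` C"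
  have carr: "carrier ?M = (\<lambda>a. B +> a) ` A"
    unfolding quot_module_def ideal_module_def A_RCOSETS_def' a_r_coset_def' by auto
  have addM: "add ?M = set_add R"
    unfolding quot_module_def ideal_module_def by (intro ext) (simp add: set_add_def')
  have zeroM: "zero ?M = B"
    unfolding quot_module_def by simp
  have smultM: "smult ?M r (B +> a) = B +> (r \<otimes> a)" if r: "r \<in> carrier R" and a: "a \<in> A" for r a
  proof -
    have *: "B +> (r \<otimes> x) = B +> (r \<otimes> a)" if x: "x \<in> B +> a" for x
    proof -
      obtain b where b: "b \<in> B" "x = b \<oplus> a" using x unfolding a_r_coset_def' by auto
      have "r \<otimes> x \<ominus> r \<otimes> a = r \<otimes> b"
        using r a b A.Icarr B.Icarr by algebra
      moreover have "r \<otimes> b \<in> B" using r b by (simp add: B.I_l_closed)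
      ultimately show ?thesis
        using a_rcos_eq_iff[OF B] r a b A.Icarr B.Icarr by simp
    qed
    have "a \<in> B +> a" using a A.Icarr by (simp add: B.a_rcos_self)
    moreover have "B +>\<^bsub>ideal_module R A\<^esub> z = B +> z" for z
      by (simp add: a_r_coset_def' ideal_module_def)
    then have "smult ?M r (B +> a) = (\<Union>x\<in>B +> a. B +> (r \<otimes> x))"
      unfolding quot_module_def by simp (simp add: ideal_module_def)
    moreover have "\<dots> = (\<Union>x\<in>B +> a. B +> (r \<otimes> a))"
      by (rule SUP_cong) (use * in auto)
    ultimately show ?thesis by auto
  qed
  have sub: "submodule (?g C) R ?M" if C: "C \<in> ideals_between R B A" for C
  proof -
    interpret C: ideal C R using C unfolding ideals_between_def by simp
    have CA: "B \<subseteq> C" "C \<subseteq> A" using C unfolding ideals_between_def by auto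
    \<comment> \<open>No group structure on the quotient has been established, so the inverse is
      identified through the uniqueness built into \<open>m_inv\<close>.\<close>
    have inv: "inv\<^bsub>add_monoid ?M\<^esub> (B +> c) = B +> (\<ominus> c)" if c: "c \<in> C" for c
      unfolding m_inv_def
    proof (rule the_equality)
      show "B +> \<ominus> c \<in> carrier (add_monoid ?M) \<and>
        (B +> c) \<otimes>\<^bsub>add_monoid ?M\<^esub> (B +> \<ominus> c) = \<one>\<^bsub>add_monoid ?M\<^esub> \<and>
        (B +> \<ominus> c) \<otimes>\<^bsub>add_monoid ?M\<^esub> (B +> c) = \<one>\<^bsub>add_monoid ?M\<^esub>"
        using c CA C.Icarr a_coset_add_zero[OF B.a_subset]
        by (auto simp: carr addM zeroM B.a_rcos_sum r_neg l_neg)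
    next
      fix Y assume Y: "Y \<in> carrier (add_monoid ?M) \<and>
        (B +> c) \<otimes>\<^bsub>add_monoid ?M\<^esub> Y = \<one>\<^bsub>add_monoid ?M\<^esub> \<and>
        Y \<otimes>\<^bsub>add_monoid ?M\<^esub> (B +> c) = \<one>\<^bsub>add_monoid ?M\<^esub>"
      then obtain a where a: "a \<in> A" "Y = B +> a" by (auto simp: carr)
      then have "B +> (a \<oplus> c) = B" using Y c A.Icarr C.Icarr
        by (simp add: carr addM zeroM B.a_rcos_sum)
      then have "a \<oplus> c \<in> B" using a c A.Icarr C.Icarr by (simp add: a_rcos_eq_self[OF B])
      moreover have "a \<ominus> (\<ominus> c) = a \<oplus> c" using a c A.Icarr C.Icarr by algebra
      ultimately show "Y = B +> \<ominus> c"
        using a c A.Icarr C.Icarr by (simp add: a_rcos_eq_iff[OF B])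
    qed
    have "B \<in> ?g C"
      using C.zero_closed a_coset_add_zero[OF B.a_subset] by (metis imageI)
    have "subgroup (?g C) (add_monoid ?M)"
    proof (rule subgroup.intro)
      show "?g C \<subseteq> carrier (add_monoid ?M)" using CA by (auto simp: carr)
      show "\<one>\<^bsub>add_monoid ?M\<^esub> \<in> ?g C" using \<open>B \<in> ?g C\<close> by (simp add: zeroM)
    next
      fix X assume "X \<in> ?g C"
      then obtain c where "c \<in> C" "X = B +> c" by blast
      then show "inv\<^bsub>add_monoid ?M\<^esub> X \<in> ?g C" by (simp add: inv)
    next
      fix X Y assume "X \<in> ?g C" "Y \<in> ?g C"
      then obtain c d where "c \<in> C" "X = B +> c" "d \<in> C" "Y = B +> d" by blast
      then show "X \<otimes>\<^bsub>add_monoid ?M\<^esub> Y \<in> ?g C"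
        by (simp add: addM B.a_rcos_sum C.Icarr)
    qed
    moreover have "submodule_axioms (?g C) R ?M"
      unfolding submodule_axioms_def using CA by (auto simp: smultM subset_iff C.I_l_closed)
    ultimately show ?thesis by (rule submodule.intro)
  qed
  have id: "?f S \<in> ideals_between R B A" if S: "submodule S R ?M" for S
  proof -
    interpret S: submodule S R ?M by fact
    have SB: "B \<in> S" using S.one_closed by (simp add: zeroM)
    have add: "X <+> Y \<in> S" if "X \<in> S" "Y \<in> S" for X Y
      using S.m_closed[OF that] by (simp add: addM)
    have mult: "r \<otimes> a \<in> ?f S" if "a \<in> ?f S" "r \<in> carrier R" for a r
    proof -
      have a: "a \<in> A" "B +> a \<in> S" using that by auto
      then have "B +> (r \<otimes> a) \<in> S"
        using S.smult_closed[OF that(2) a(2)] unfolding smultM[OF that(2) a(1)] by simp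
      then show ?thesis using a that by (simp add: A.I_l_closed)
    qed
    have "ideal (?f S) R"
    proof (rule idealI)
      show "ring R" by (rule ring_axioms)
      show "subgroup (?f S) (add_monoid R)"
      proof
        show "?f S \<subseteq> carrier (add_monoid R)" using A.Icarr by auto
        show "\<one>\<^bsub>add_monoid R\<^esub> \<in> ?f S"
          using SB a_coset_add_zero[OF B.a_subset] by simp
        show "a \<otimes>\<^bsub>add_monoid R\<^esub> b \<in> ?f S" if "a \<in> ?f S" "b \<in> ?f S" for a b
          using that add[of "B +> a" "B +> b"] A.Icarr by (auto simp: B.a_rcos_sum)
        show "inv\<^bsub>add_monoid R\<^esub> a \<in> ?f S" if "a \<in> ?f S" for a
        proof -
          have "\<ominus> a = \<ominus> \<one> \<otimes> a" using that A.Icarr by (simp add: l_minus)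
          then show ?thesis using mult[OF that, of "\<ominus> \<one>"] by (simp add: a_inv_def)
        qed
      qed
      show "r \<otimes> a \<in> ?f S" if "a \<in> ?f S" "r \<in> carrier R" for a r by (rule mult[OF that])
      show "a \<otimes> r \<in> ?f S" if "a \<in> ?f S" "r \<in> carrier R" for a r
        using mult[OF that] that A.Icarr m_comm[of a r] by simp
    qed
    moreover have "B \<subseteq> ?f S"
    proof
      fix b assume b: "b \<in> B"
      then have "B +> b = B" by (simp add: a_rcos_eq_self[OF B])
      then show "b \<in> ?f S" using b BA SB by auto
    qed
    ultimately show ?thesis unfolding ideals_between_def by auto
  qed
  have fg: "?f (?g C) = C" if C: "C \<in> ideals_between R B A" for C
  proof -
    interpret C: ideal C R using C unfolding ideals_between_def by simp
    have CA: "B \<subseteq> C" "C \<subseteq> A" using C unfolding ideals_between_def by auto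
    have "a \<in> C" if a: "a \<in> A" "c \<in> C" "B +> a = B +> c" for a c
    proof -
      have "a \<ominus> c \<in> C" using a CA A.Icarr C.Icarr by (auto simp: a_rcos_eq_iff[OF B])
      then have "(a \<ominus> c) \<oplus> c \<in> C" using a by simp
      moreover have "(a \<ominus> c) \<oplus> c = a" using a A.Icarr C.Icarr by algebra
      ultimately show ?thesis by simp
    qed
    then show ?thesis using CA by auto
  qed
  have gf: "?g (?f S) = S" if S: "submodule S R ?M" for S
  proof -
    interpret S: submodule S R ?M by fact
    have "S \<subseteq> (\<lambda>a. B +> a) ` A" using S.subset by (simp add: carr)
    then show ?thesis by auto
  qed
  have "chain_length {S. submodule S R ?M} = chain_length (ideals_between R B A)"
    by (rule chain_length_eq_iso[of _ ?f _ ?g]) (use sub id fg gf in auto)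
  then show ?thesis
    unfolding quot_length_def module_length_def chain_length_def by simp
qed


lemma cring_idealI:
  assumes "I \<subseteq> carrier R" "\<zero> \<in> I"
    and "\<And>a b. \<lbrakk>a \<in> I; b \<in> I\<rbrakk> \<Longrightarrow> a \<oplus> b \<in> I"
    and mult: "\<And>r a. \<lbrakk>r \<in> carrier R; a \<in> I\<rbrakk> \<Longrightarrow> r \<otimes> a \<in> I"
  shows "ideal I R"
proof (rule idealI)
  show "ring R" by (rule ring_axioms)
  show "subgroup I (add_monoid R)"
  proof
    fix a assume a: "a \<in> I"
    then have "\<ominus> a = \<ominus> \<one> \<otimes> a" using assms(1) by (auto simp: l_minus)
    then show "inv\<^bsub>add_monoid R\<^esub> a \<in> I" using mult[of "\<ominus> \<one>" a] a by (simp add: a_inv_def)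
  qed (use assms(1-3) in auto)
  show "r \<otimes> a \<in> I" if "a \<in> I" "r \<in> carrier R" for a r
    using that by (simp add: mult)
  then show "a \<otimes> r \<in> I" if "a \<in> I" "r \<in> carrier R" for a r
    using that assms(1) m_comm[of a r] by auto
qed

lemma ideal_preimage_mult:
  assumes "ideal A R" "ideal B R" "a \<in> carrier R"
  shows "ideal {r \<in> A. r \<otimes> a \<in> B} R"
proof -
  interpret A: ideal A R by fact
  interpret B: ideal B R by fact
  show ?thesis
    by (rule cring_idealI)
      (use assms(3) in \<open>auto simp: A.Icarr l_distr m_assoc A.I_l_closed B.I_l_closed\<close>)
qed

lemma ideal_mult_add:
  assumes "ideal A R" "ideal B R" "a \<in> carrier R"
  shows "ideal {r \<otimes> a \<oplus> b | r b. r \<in> A \<and> b \<in> B} R"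
proof -
  interpret A: ideal A R by fact
  interpret B: ideal B R by fact
  show ?thesis
  proof (rule cring_idealI)
    show "{r \<otimes> a \<oplus> b | r b. r \<in> A \<and> b \<in> B} \<subseteq> carrier R"
      using assms(3) A.Icarr B.Icarr by auto
    show "\<zero> \<in> {r \<otimes> a \<oplus> b | r b. r \<in> A \<and> b \<in> B}"
      using assms(3) by (auto intro!: exI[of _ \<zero>])
    fix u assume "u \<in> {r \<otimes> a \<oplus> b | r b. r \<in> A \<and> b \<in> B}"
    then obtain r b where u: "u = r \<otimes> a \<oplus> b" "r \<in> A" "b \<in> B" by blast
    {
      fix v assume "v \<in> {r \<otimes> a \<oplus> b | r b. r \<in> A \<and> b \<in> B}"
      then obtain s c where v: "v = s \<otimes> a \<oplus> c" "s \<in> A" "c \<in> B" by blast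
      have "u \<oplus> v = (r \<oplus> s) \<otimes> a \<oplus> (b \<oplus> c)"
        using u v assms(3) A.Icarr[OF u(2)] A.Icarr[OF v(2)] B.Icarr[OF u(3)] B.Icarr[OF v(3)]
        by algebra
      then show "u \<oplus> v \<in> {r \<otimes> a \<oplus> b | r b. r \<in> A \<and> b \<in> B}"
        using u v A.a_closed B.a_closed by blast
    next
      fix s assume s: "s \<in> carrier R"
      have "s \<otimes> u = (s \<otimes> r) \<otimes> a \<oplus> s \<otimes> b"
        using u s assms(3) A.Icarr[OF u(2)] B.Icarr[OF u(3)] by algebra
      then show "s \<otimes> u \<in> {r \<otimes> a \<oplus> b | r b. r \<in> A \<and> b \<in> B}"
        using u s A.I_l_closed B.I_l_closed by blast
    }
  qed
qed

text \<open>The last three hypotheses say D = Aa + B, so multiplication by \<open>a\<close> maps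
  \<open>A\<close> onto D/B. On ideals the isomorphism is the preimage in one direction and Y
  \<mapsto> Ya + B in the other.\<close>

lemma quot_length_mult:
  assumes A: "ideal A R" and B: "ideal B R" and D: "ideal D R" and a: "a \<in> carrier R"
    and BD: "B \<subseteq> D" and AD: "\<And>r. r \<in> A \<Longrightarrow> r \<otimes> a \<in> D"
    and DA: "\<And>d. d \<in> D \<Longrightarrow> \<exists>r\<in>A. \<exists>b\<in>B. d = r \<otimes> a \<oplus> b"
  shows "quot_length R D B = quot_length R A {r \<in> A. r \<otimes> a \<in> B}"
proof -
  interpret A: ideal A R by fact
  interpret B: ideal B R by fact
  interpret D: ideal D R by fact
  let ?E = "{r \<in> A. r \<otimes> a \<in> B}"
  let ?f = "\<lambda>X. {r \<in> A. r \<otimes> a \<in> X}" and ?g = "\<lambda>Y. {r \<otimes> a \<oplus> b | r b. r \<in> Y \<and> b \<in> B}"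
  have f: "?f X \<in> ideals_between R ?E A" and gf: "?g (?f X) = X" if X: "X \<in> ideals_between R B D" for X
  proof -
    interpret X: ideal X R using X unfolding ideals_between_def by simp
    show "?f X \<in> ideals_between R ?E A"
      using X ideal_preimage_mult[OF A X.is_ideal a] unfolding ideals_between_def by auto
    show "?g (?f X) = X"
    proof
      show "?g (?f X) \<subseteq> X" using X unfolding ideals_between_def by auto
      show "X \<subseteq> ?g (?f X)"
      proof
        fix d assume d: "d \<in> X"
        then obtain r b where r: "r \<in> A" "b \<in> B" "d = r \<otimes> a \<oplus> b"
          using DA[of d] X unfolding ideals_between_def by blast
        then have "b \<in> X" using X unfolding ideals_between_def by auto
        then have "d \<oplus> \<ominus> b \<in> X" using d by auto
        moreover have "d \<oplus> \<ominus> b = r \<otimes> a" using r a A.Icarr[OF r(1)] B.Icarr[OF r(2)] by algebra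
        ultimately show "d \<in> ?g (?f X)" using r by auto
      qed
    qed
  qed
  have g: "?g Y \<in> ideals_between R B D" and fg: "?f (?g Y) = Y" if Y: "Y \<in> ideals_between R ?E A" for Y
  proof -
    interpret Y: ideal Y R using Y unfolding ideals_between_def by simp
    have Y': "?E \<subseteq> Y" "Y \<subseteq> A" using Y unfolding ideals_between_def by auto
    have "B \<subseteq> ?g Y"
    proof
      fix b assume b: "b \<in> B"
      then have "b = \<zero> \<otimes> a \<oplus> b" using a B.Icarr by simp
      then show "b \<in> ?g Y" using b Y.zero_closed by blast
    qed
    moreover have "?g Y \<subseteq> D" using Y' BD AD D.a_closed by blast
    ultimately show "?g Y \<in> ideals_between R B D"
      using ideal_mult_add[OF Y.is_ideal B a] unfolding ideals_between_def by auto
    show "?f (?g Y) = Y"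
    proof
      show "Y \<subseteq> ?f (?g Y)"
      proof
        fix r assume r: "r \<in> Y"
        then have "r \<otimes> a = r \<otimes> a \<oplus> \<zero>" using a Y.Icarr by simp
        then show "r \<in> ?f (?g Y)" using r Y' B.zero_closed by blast
      qed
      show "?f (?g Y) \<subseteq> Y"
      proof
        fix s assume "s \<in> ?f (?g Y)"
        then obtain r b where s: "s \<in> A" "r \<in> Y" "b \<in> B" "s \<otimes> a = r \<otimes> a \<oplus> b" by blast
        note c = A.Icarr[OF s(1)] Y.Icarr[OF s(2)] B.Icarr[OF s(3)]
        \<comment> \<open>\<open>Y\<close> contains the kernel \<open>?E\<close>, so it suffices
          that multiplication by \<open>a\<close> sends s - r into \<open>B\<close>.\<close>
        have "(s \<ominus> r) \<otimes> a = s \<otimes> a \<ominus> r \<otimes> a" using a c by algebra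
        also have "\<dots> = b" unfolding s(4) using a c by algebra
        finally have "(s \<ominus> r) \<otimes> a \<in> B" using s by simp
        moreover have "s \<ominus> r \<in> A" using s Y' by (auto simp: a_minus_def)
        ultimately have "s \<ominus> r \<in> Y" using Y' by auto
        then have "(s \<ominus> r) \<oplus> r \<in> Y" using s by simp
        moreover have "(s \<ominus> r) \<oplus> r = s" using c by algebra
        ultimately show "s \<in> Y" by simp
      qed
    qed
  qed
  have "chain_length (ideals_between R B D) = chain_length (ideals_between R ?E A)"
    by (rule chain_length_eq_iso[of _ ?f _ ?g, OF conjI[OF f gf] conjI[OF g fg]]) blast+
  then show ?thesis
    using A B D BD ideal_preimage_mult[OF A B a] by (simp add: quot_length_eq_chain_length)
qed

text \<open>This is the modular law: a strict inclusion cannot disappear both after intersecting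
  with \<open>C\<close> and after adding \<open>C\<close>.\<close>

lemma ideals_modular_eq:
  assumes "ideal C R" "ideal D R" "ideal D' R" "D \<subseteq> D'" "D \<inter> C = D' \<inter> C" "D <+>\<^bsub>R\<^esub> C = D' <+>\<^bsub>R\<^esub> C"
  shows "D = D'"
proof
  interpret C: ideal C R by fact
  interpret D: ideal D R by fact
  interpret D': ideal D' R by fact
  show "D' \<subseteq> D"
  proof
    fix d' assume d': "d' \<in> D'"
    then have "d' \<oplus> \<zero> \<in> D' <+>\<^bsub>R\<^esub> C" using C.zero_closed unfolding set_add_def' by blast
    then have "d' \<in> D <+>\<^bsub>R\<^esub> C" using assms(6) d' D'.Icarr by simp
    then obtain d c where d: "d \<in> D" "c \<in> C" "d' = d \<oplus> c" unfolding set_add_def' by blast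
    have "c = d' \<oplus> \<ominus> d" using d D.Icarr[OF d(1)] C.Icarr[OF d(2)] by algebra
    moreover have "d' \<oplus> \<ominus> d \<in> D'" using d(1) d' assms(4) by blast
    ultimately have "c \<in> D' \<inter> C" using d(2) by simp
    then have "c \<in> D" using assms(5) by auto
    then show "d' \<in> D" using d by simp
  qed
qed fact

text \<open>For one inequality, chains below and above \<open>C\<close> are concatenated. For the
  other, a chain is both intersected with \<open>C\<close> and added to \<open>C\<close>, and each
  of its steps stays strict in at least one of the two images.\<close>

theorem quot_length_add:
  assumes A: "ideal A R" and B: "ideal B R" and C: "ideal C R" and BC: "B \<subseteq> C" and CA: "C \<subseteq> A"
  shows "quot_length R A B = quot_length R A C + quot_length R C B"
proof -
  interpret A: ideal A R by fact
  interpret B: ideal B R by fact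
  interpret C: ideal C R by fact
  let ?S = "ideals_between R B C" and ?T = "ideals_between R C A" and ?U = "ideals_between R B A"
  have "chain_length ?S + chain_length ?T \<le> chain_length ?U"
  proof (rule chain_length_append)
    show "?S \<noteq> {}" "?T \<noteq> {}" using A B C BC CA unfolding ideals_between_def by auto
  qed (use BC CA in \<open>auto simp: ideals_between_def\<close>)
  moreover have "chain_length ?U \<le> chain_length ?S + chain_length ?T"
  proof (rule chain_length_least)
    fix l D assume D: "\<And>i. i \<le> l \<Longrightarrow> D i \<in> ?U" "\<And>i. i < l \<Longrightarrow> D i \<subset> D (Suc i)"
    define E where "E i = D i \<inter> C" for i
    define G where "G i = D i <+>\<^bsub>R\<^esub> C" for i
    have DI: "ideal (D i) R" "B \<subseteq> D i" "D i \<subseteq> A" if "i \<le> l" for i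
      using D(1)[OF that] unfolding ideals_between_def by auto
    have S: "enat (card {i. i < l \<and> E i \<noteq> E (Suc i)}) \<le> chain_length ?S"
    proof (rule chain_length_weak_chain)
      show "E i \<in> ?S" if "i \<le> l" for i
        using DI[OF that] C BC i_intersect[of "D i" C] unfolding ideals_between_def E_def by auto
      show "E i \<subseteq> E (Suc i)" if "i < l" for i using D(2)[OF that] unfolding E_def by auto
    qed
    have T: "enat (card {i. i < l \<and> G i \<noteq> G (Suc i)}) \<le> chain_length ?T"
    proof (rule chain_length_weak_chain)
      fix i assume i: "i \<le> l"
      interpret Di: ideal "D i" R using DI[OF i] by simp
      have "C \<subseteq> G i"
      proof
        fix c assume c: "c \<in> C"
        then have "c = \<zero> \<oplus> c" using C.Icarr by simp
        then show "c \<in> G i" using c Di.zero_closed unfolding G_def set_add_def' by blast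
      qed
      moreover have "G i \<subseteq> A" using DI[OF i] CA A.a_closed unfolding G_def set_add_def' by blast
      ultimately show "G i \<in> ?T"
        using add_ideals[OF Di.is_ideal C] unfolding ideals_between_def G_def by auto
    next
      show "G i \<subseteq> G (Suc i)" if "i < l" for i using D(2)[OF that] unfolding G_def set_add_def' by blast
    qed
    have "i \<in> {i. i < l \<and> E i \<noteq> E (Suc i)} \<union> {i. i < l \<and> G i \<noteq> G (Suc i)}" if i: "i < l" for i
    proof -
      have "D i \<noteq> D (Suc i)" using D(2)[OF i] by auto
      then have "E i \<noteq> E (Suc i) \<or> G i \<noteq> G (Suc i)"
        using ideals_modular_eq[OF C DI(1)[of i] DI(1)[of "Suc i"]] D(2)[OF i] i
        unfolding E_def G_def by auto
      then show ?thesis using i by simp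
    qed
    then have "card {..<l} \<le> card ({i. i < l \<and> E i \<noteq> E (Suc i)} \<union> {i. i < l \<and> G i \<noteq> G (Suc i)})"
      by (intro card_mono) auto
    also have "\<dots> \<le> card {i. i < l \<and> E i \<noteq> E (Suc i)} + card {i. i < l \<and> G i \<noteq> G (Suc i)}"
      by (rule card_Un_le)
    finally have "enat l \<le> enat (card {i. i < l \<and> E i \<noteq> E (Suc i)}) + enat (card {i. i < l \<and> G i \<noteq> G (Suc i)})"
      by simp
    also have "\<dots> \<le> chain_length ?S + chain_length ?T" by (rule add_mono[OF S T])
    finally show "enat l \<le> chain_length ?S + chain_length ?T" .
  qed
  ultimately have "chain_length ?U = chain_length ?T + chain_length ?S" by (simp add: add.commute)
  then show ?thesis using A B C BC CA by (simp add: quot_length_eq_chain_length)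
qed

corollary quot_length_anti:
  assumes "ideal A R" "ideal B R" "ideal C R" "B \<subseteq> C" "C \<subseteq> A"
  shows "quot_length R A C \<le> quot_length R A B"
  using quot_length_add[OF assms] by (simp add: le_iff_add)

lemma quot_length_self:
  assumes "ideal A R"
  shows "quot_length R A A = 0"
proof -
  have "chain_length (ideals_between R A A) \<le> 0"
  proof (rule chain_length_least)
    fix l C assume C: "\<And>i. i \<le> l \<Longrightarrow> C i \<in> ideals_between R A A" "\<And>i. i < l \<Longrightarrow> C i \<subset> C (Suc i)"
    have "l = 0"
    proof (rule ccontr)
      assume "l \<noteq> 0"
      then show False using C(1)[of 0] C(1)[of 1] C(2)[of 0] unfolding ideals_between_def by auto
    qed
    then show "enat l \<le> 0" by (simp add: zero_enat_def)
  qed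
  then show ?thesis using assms by (simp add: quot_length_eq_chain_length)
qed

lemma quot_length_eq_0_imp_eq:
  assumes "ideal A R" "ideal B R" "B \<subseteq> A" "quot_length R A B = 0"
  shows "B = A"
proof (rule ccontr)
  assume "B \<noteq> A"
  then have "enat 1 \<le> chain_length (ideals_between R B A)"
    using assms(1-3)
    by (intro chain_length_upper[of _ "\<lambda>i. if i = 0 then B else A"]) (auto simp: ideals_between_def)
  then show False using assms by (simp add: quot_length_eq_chain_length zero_enat_def)
qed

end

section \<open>Acyclic and regular pairs\<close>

context cring
begin

lemma mem_Idl_pair_iff:
  assumes "x \<in> carrier R" "y \<in> carrier R"
  shows "d \<in> Idl {x, y} \<longleftrightarrow> (\<exists>r\<in>carrier R. \<exists>s\<in>carrier R. d = r \<otimes> x \<oplus> s \<otimes> y)"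
proof
  interpret I: ideal "Idl {x, y}" R using assms by (intro genideal_ideal) auto
  have xy: "x \<in> Idl {x, y}" "y \<in> Idl {x, y}" using genideal_self[of "{x, y}"] assms by auto
  show "d \<in> Idl {x, y}" if "\<exists>r\<in>carrier R. \<exists>s\<in>carrier R. d = r \<otimes> x \<oplus> s \<otimes> y"
    using that xy I.I_l_closed I.a_closed by blast
  let ?D = "{r \<otimes> x \<oplus> b | r b. r \<in> carrier R \<and> b \<in> PIdl y}"
  have D: "ideal ?D R" using assms by (intro ideal_mult_add oneideal cgenideal_ideal)
  have "x = \<one> \<otimes> x \<oplus> \<zero> \<otimes> y" "y = \<zero> \<otimes> x \<oplus> \<one> \<otimes> y" using assms by simp_all
  then have "{x, y} \<subseteq> ?D" unfolding cgenideal_def by blast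
  then have "Idl {x, y} \<subseteq> ?D" by (rule genideal_minimal[OF D])
  then show "\<exists>r\<in>carrier R. \<exists>s\<in>carrier R. d = r \<otimes> x \<oplus> s \<otimes> y" if "d \<in> Idl {x, y}"
    using that unfolding cgenideal_def by blast
qed

lemma mem_Idl_pair_prod_iff:
  assumes "x \<in> carrier R" "y \<in> carrier R" "ideal L R"
  shows "d \<in> (Idl {x, y}) \<cdot> L \<longleftrightarrow> (\<exists>p\<in>L. \<exists>q\<in>L. d = p \<otimes> x \<oplus> q \<otimes> y)"
proof
  interpret L: ideal L R by fact
  have xy: "x \<in> Idl {x, y}" "y \<in> Idl {x, y}" using genideal_self[of "{x, y}"] assms by auto
  assume "\<exists>p\<in>L. \<exists>q\<in>L. d = p \<otimes> x \<oplus> q \<otimes> y"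
  then obtain p q where pq: "p \<in> L" "q \<in> L" "d = p \<otimes> x \<oplus> q \<otimes> y" by blast
  then have "d = x \<otimes> p \<oplus> y \<otimes> q" using assms L.Icarr by (simp add: m_comm)
  then show "d \<in> (Idl {x, y}) \<cdot> L" using xy pq by (auto intro: ideal_prod.intros)
next
  interpret L: ideal L R by fact
  assume "d \<in> (Idl {x, y}) \<cdot> L"
  then show "\<exists>p\<in>L. \<exists>q\<in>L. d = p \<otimes> x \<oplus> q \<otimes> y"
  proof induction
    case (prod i j)
    then obtain r s where rs: "r \<in> carrier R" "s \<in> carrier R" "i = r \<otimes> x \<oplus> s \<otimes> y"
      using assms by (auto simp: mem_Idl_pair_iff)
    have "i \<otimes> j = (r \<otimes> j) \<otimes> x \<oplus> (s \<otimes> j) \<otimes> y"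
      using rs L.Icarr[OF prod(2)] assms(1,2) by algebra
    then show ?case using rs prod(2) L.I_l_closed by blast
  next
    case (sum d e)
    then obtain p q p' q' where *: "p \<in> L" "q \<in> L" "d = p \<otimes> x \<oplus> q \<otimes> y"
      "p' \<in> L" "q' \<in> L" "e = p' \<otimes> x \<oplus> q' \<otimes> y" by blast
    then have "d \<oplus> e = (p \<oplus> p') \<otimes> x \<oplus> (q \<oplus> q') \<otimes> y"
      using assms(1,2) L.Icarr[OF *(1)] L.Icarr[OF *(2)] L.Icarr[OF *(4)] L.Icarr[OF *(5)] by algebra
    then show ?case using * L.a_closed by blast
  qed
qed

lemma ideal_colon:
  assumes "ideal A R" "B \<subseteq> carrier R"
  shows "ideal (colon R A B) R"
proof -
  interpret A: ideal A R by fact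
  show ?thesis
    by (rule cring_idealI)
      (use assms(2) in \<open>auto simp: colon_def l_distr m_assoc A.I_l_closed subset_iff\<close>)
qed

lemma mem_colon_Idl_pair_iff:
  assumes "x \<in> carrier R" "y \<in> carrier R" "ideal L R"
  shows "r \<in> colon R L (Idl {x, y}) \<longleftrightarrow> r \<in> carrier R \<and> r \<otimes> x \<in> L \<and> r \<otimes> y \<in> L"
proof -
  interpret L: ideal L R by fact
  have xy: "x \<in> Idl {x, y}" "y \<in> Idl {x, y}" using genideal_self[of "{x, y}"] assms by auto
  have "r \<otimes> b \<in> L" if r: "r \<in> carrier R" "r \<otimes> x \<in> L" "r \<otimes> y \<in> L" and b: "b \<in> Idl {x, y}" for b
  proof -
    obtain s t where st: "s \<in> carrier R" "t \<in> carrier R" "b = s \<otimes> x \<oplus> t \<otimes> y"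
      using b assms by (auto simp: mem_Idl_pair_iff)
    then have "r \<otimes> b = s \<otimes> (r \<otimes> x) \<oplus> t \<otimes> (r \<otimes> y)" using r assms(1,2) by algebra
    then show ?thesis using st r L.I_l_closed L.a_closed by simp
  qed
  then show ?thesis using xy unfolding colon_def by auto
qed

end

text \<open>Exactness of the Koszul complex of \<open>x, y\<close> in the middle degree.\<close>

locale acyclic_pair = cring +
  fixes x y
  assumes x_carr: "x \<in> carrier R" and y_carr: "y \<in> carrier R"
    and syzygy: "\<lbrakk>p \<in> carrier R; q \<in> carrier R; p \<otimes> x \<oplus> q \<otimes> y = \<zero>\<rbrakk>
      \<Longrightarrow> \<exists>u\<in>carrier R. p = \<ominus> (u \<otimes> y) \<and> q = u \<otimes> x"
begin

abbreviation J :: "'a set" where "J \<equiv> Idl {x, y}"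

lemma J_ideal: "ideal J R"
  using x_carr y_carr by (intro genideal_ideal) auto

lemma J_subset: "J \<subseteq> carrier R"
  using ideal.Icarr[OF J_ideal] by blast

text \<open>Cut J/JL at X = xR + JL. Exactness identifies J/X with R/S for S = xR + L, and X/JL with
  R/E for E = y(L : x) + L. On the other hand S/L is isomorphic to R/(L : x), and E/L to (L : x)/(L
  : J). Splitting one copy of \<lambda>(R/L) at S and the other at E gives the formula.\<close>

lemma quot_length_J_prod_colon:
  assumes L: "ideal L R"
  shows "quot_length R J (J \<cdot> L) + quot_length R (carrier R) (colon R L J)
    = quot_length R (carrier R) L + quot_length R (carrier R) L"
proof -
  interpret L: ideal L R by fact
  let ?ql = "quot_length R"
  note xy = x_carr y_carr
  define X where "X = {r \<otimes> x \<oplus> b | r b. r \<in> carrier R \<and> b \<in> J \<cdot> L}"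
  define Lx where "Lx = {r \<in> carrier R. r \<otimes> x \<in> L}"
  define E where "E = {r \<otimes> y \<oplus> b | r b. r \<in> Lx \<and> b \<in> L}"
  define S where "S = {r \<otimes> x \<oplus> b | r b. r \<in> carrier R \<and> b \<in> L}"
  have JL: "ideal (J \<cdot> L) R" by (intro ideal_prod_is_ideal J_ideal L)
  have X: "ideal X R" unfolding X_def by (intro ideal_mult_add oneideal JL xy)
  have Lx: "ideal Lx R" unfolding Lx_def by (intro ideal_preimage_mult oneideal L xy)
  have E: "ideal E R" unfolding E_def by (intro ideal_mult_add Lx L xy)
  have S: "ideal S R" unfolding S_def by (intro ideal_mult_add oneideal L xy)
  have C: "ideal (colon R L J) R" by (intro ideal_colon L J_subset)
  interpret X: ideal X R by (fact X)
  interpret JL: ideal "J \<cdot> L" R by (fact JL)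
  interpret J: ideal J R by (fact J_ideal)
  have JLX: "J \<cdot> L \<subseteq> X"
  proof
    fix b assume b: "b \<in> J \<cdot> L"
    then have "b = \<zero> \<otimes> x \<oplus> b" using xy JL.Icarr by simp
    then show "b \<in> X" unfolding X_def using b by blast
  qed
  have XJ: "X \<subseteq> J"
  proof -
    have "J \<cdot> L \<subseteq> J" using ideal_prod_inter[OF J_ideal L] by simp
    moreover have "x \<in> J" using genideal_self[of "{x, y}"] xy by auto
    ultimately show ?thesis unfolding X_def using J.a_closed J.I_l_closed by blast
  qed
  have LS: "L \<subseteq> S" "L \<subseteq> E"
  proof -
    have "b = \<zero> \<otimes> x \<oplus> b" "b = \<zero> \<otimes> y \<oplus> b" if "b \<in> L" for b using xy that L.Icarr by simp_all
    moreover have "\<zero> \<in> Lx" using Lx by (simp add: additive_subgroup.zero_closed ideal.axioms(1))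
    ultimately show "L \<subseteq> S" "L \<subseteq> E" unfolding S_def E_def by blast+
  qed
  have 1: "?ql J (J \<cdot> L) = ?ql J X + ?ql X (J \<cdot> L)"
    by (rule quot_length_add[OF J_ideal JL X JLX XJ])
  have "?ql J X = ?ql (carrier R) {r \<in> carrier R. r \<otimes> y \<in> X}"
  proof (rule quot_length_mult[OF oneideal X J_ideal y_carr XJ])
    show "r \<otimes> y \<in> J" if "r \<in> carrier R" for r
      using that genideal_self[of "{x, y}"] xy J.I_l_closed by auto
    show "\<exists>r\<in>carrier R. \<exists>b\<in>X. d = r \<otimes> y \<oplus> b" if "d \<in> J" for d
    proof -
      obtain r s where rs: "r \<in> carrier R" "s \<in> carrier R" "d = r \<otimes> x \<oplus> s \<otimes> y"
        using \<open>d \<in> J\<close> xy by (auto simp: mem_Idl_pair_iff)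
      then have "d = s \<otimes> y \<oplus> (r \<otimes> x \<oplus> \<zero>)" using xy by algebra
      then show ?thesis using rs JL.zero_closed unfolding X_def by blast
    qed
  qed
  also have "{r \<in> carrier R. r \<otimes> y \<in> X} = S"
  proof (intro equalityI subsetI)
    fix r assume "r \<in> {r \<in> carrier R. r \<otimes> y \<in> X}"
    then obtain s b where r: "r \<in> carrier R" "s \<in> carrier R" "b \<in> J \<cdot> L" "r \<otimes> y = s \<otimes> x \<oplus> b"
      unfolding X_def by blast
    then obtain p q where pq: "p \<in> L" "q \<in> L" "b = p \<otimes> x \<oplus> q \<otimes> y"
      using xy L by (auto simp: mem_Idl_pair_prod_iff)
    note c = L.Icarr[OF pq(1)] L.Icarr[OF pq(2)]
    \<comment> \<open>The relation ry = sx + px + qy is a syzygy of x, y. It makes r - q a multiple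
      of x, so r lies in xR + L.\<close>
    have "(\<ominus> s \<ominus> p) \<otimes> x \<oplus> (r \<ominus> q) \<otimes> y = r \<otimes> y \<ominus> (s \<otimes> x \<oplus> (p \<otimes> x \<oplus> q \<otimes> y))"
      using r(1,2) c xy by algebra
    also have "\<dots> = \<zero>" unfolding r(4) pq(3) using r(1,2) c xy by algebra
    finally obtain u where u: "u \<in> carrier R" "r \<ominus> q = u \<otimes> x"
      using syzygy[of "\<ominus> s \<ominus> p" "r \<ominus> q"] r c by auto
    have "r = (r \<ominus> q) \<oplus> q" using r(1) c by algebra
    then show "r \<in> S" unfolding S_def using u pq by auto
  next
    fix r assume "r \<in> S"
    then obtain s b where r: "r = s \<otimes> x \<oplus> b" "s \<in> carrier R" "b \<in> L" unfolding S_def by blast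
    note b = L.Icarr[OF r(3)]
    have "r \<otimes> y = (s \<otimes> y) \<otimes> x \<oplus> (\<zero> \<otimes> x \<oplus> b \<otimes> y)" unfolding r(1) using r(2) b xy by algebra
    moreover have "\<zero> \<otimes> x \<oplus> b \<otimes> y \<in> J \<cdot> L"
      using L.zero_closed r(3) by (subst mem_Idl_pair_prod_iff[OF xy L]) blast
    ultimately show "r \<in> {r \<in> carrier R. r \<otimes> y \<in> X}"
      unfolding X_def using r b xy by blast
  qed
  finally have 2: "?ql J X = ?ql (carrier R) S" .
  have "?ql X (J \<cdot> L) = ?ql (carrier R) {r \<in> carrier R. r \<otimes> x \<in> J \<cdot> L}"
  proof (rule quot_length_mult[OF oneideal JL X x_carr JLX])
    show "r \<otimes> x \<in> X" if "r \<in> carrier R" for r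
    proof -
      have "r \<otimes> x = r \<otimes> x \<oplus> \<zero>" using that xy by simp
      then show ?thesis using that JL.zero_closed unfolding X_def by blast
    qed
    show "\<exists>r\<in>carrier R. \<exists>b\<in>J \<cdot> L. d = r \<otimes> x \<oplus> b" if "d \<in> X" for d
      using that unfolding X_def by blast
  qed
  also have "{r \<in> carrier R. r \<otimes> x \<in> J \<cdot> L} = E"
  proof (intro equalityI subsetI)
    fix r assume "r \<in> {r \<in> carrier R. r \<otimes> x \<in> J \<cdot> L}"
    then obtain p q where r: "r \<in> carrier R" "p \<in> L" "q \<in> L" "r \<otimes> x = p \<otimes> x \<oplus> q \<otimes> y"
      using xy L by (auto simp: mem_Idl_pair_prod_iff)
    note c = L.Icarr[OF r(2)] L.Icarr[OF r(3)]
    \<comment> \<open>Here the syzygy is (p - r, q). From q = ux \<in> L it follows that u lies in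
      (L : x), and then r = uy + p.\<close>
    have "(p \<ominus> r) \<otimes> x \<oplus> q \<otimes> y = p \<otimes> x \<oplus> q \<otimes> y \<ominus> r \<otimes> x" using r(1) c xy by algebra
    also have "\<dots> = \<zero>" unfolding r(4) using r(1) c xy by algebra
    finally obtain u where u: "u \<in> carrier R" "p \<ominus> r = \<ominus> (u \<otimes> y)" "q = u \<otimes> x"
      using syzygy[of "p \<ominus> r" q] r c by auto
    have "r = p \<ominus> (p \<ominus> r)" using r(1) c by algebra
    also have "\<dots> = u \<otimes> y \<oplus> p" unfolding u(2) using u(1) c xy by algebra
    finally show "r \<in> E" unfolding E_def Lx_def using u r by blast
  next
    fix r assume "r \<in> E"
    then obtain s b where r: "r = s \<otimes> y \<oplus> b" "s \<in> carrier R" "s \<otimes> x \<in> L" "b \<in> L"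
      unfolding E_def Lx_def by blast
    note b = L.Icarr[OF r(4)]
    have "r \<otimes> x = b \<otimes> x \<oplus> (s \<otimes> x) \<otimes> y" unfolding r(1) using r(2) b xy by algebra
    then show "r \<in> {r \<in> carrier R. r \<otimes> x \<in> J \<cdot> L}"
      using mem_Idl_pair_prod_iff[OF xy L] r b xy by blast
  qed
  finally have 3: "?ql X (J \<cdot> L) = ?ql (carrier R) E" .
  have 4: "?ql (carrier R) L = ?ql (carrier R) E + ?ql E L"
    using LS E by (intro quot_length_add oneideal L) (auto dest: ideal.Icarr)
  have CLx: "{r \<in> Lx. r \<otimes> y \<in> L} = colon R L J"
    unfolding Lx_def using xy L by (auto simp: mem_colon_Idl_pair_iff)
  have "?ql E L = ?ql Lx {r \<in> Lx. r \<otimes> y \<in> L}"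
  proof (rule quot_length_mult[OF Lx L E y_carr LS(2)])
    show "r \<otimes> y \<in> E" if "r \<in> Lx" for r
    proof -
      have "r \<otimes> y = r \<otimes> y \<oplus> \<zero>" using that xy unfolding Lx_def by simp
      then show ?thesis using that L.zero_closed unfolding E_def by blast
    qed
  qed (auto simp: E_def)
  then have 5: "?ql E L = ?ql Lx (colon R L J)" unfolding CLx .
  have 6: "?ql (carrier R) (colon R L J) = ?ql (carrier R) Lx + ?ql Lx (colon R L J)"
    using CLx by (intro quot_length_add oneideal Lx C) (auto simp: Lx_def)
  have "?ql S L = ?ql (carrier R) {r \<in> carrier R. r \<otimes> x \<in> L}"
  proof (rule quot_length_mult[OF oneideal L S x_carr LS(1)])
    show "r \<otimes> x \<in> S" if "r \<in> carrier R" for r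
    proof -
      have "r \<otimes> x = r \<otimes> x \<oplus> \<zero>" using that xy by simp
      then show ?thesis using that L.zero_closed unfolding S_def by blast
    qed
  qed (auto simp: S_def)
  then have 7: "?ql S L = ?ql (carrier R) Lx" unfolding Lx_def .
  have 8: "?ql (carrier R) L = ?ql (carrier R) S + ?ql S L"
    using LS S by (intro quot_length_add oneideal L) (auto dest: ideal.Icarr)
  \<comment> \<open>\<lambda>(R/(L : J)) is split at \<open>Lx\<close>, that is (L : x); its two
    pieces complete R/S and R/E to R/L.\<close>
  have "?ql J (J \<cdot> L) + ?ql (carrier R) (colon R L J)
      = (?ql (carrier R) S + ?ql S L) + (?ql (carrier R) E + ?ql E L)"
    unfolding 1 2 3 6 5 7 by (simp add: ac_simps)
  then show ?thesis using 4 8 by simp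
qed

end

section \<open>Ideal powers, finite colength and regular sequences of length two\<close>

context cring
begin

lemma ideals_set_one [simp]: "\<one>\<^bsub>ideals_set R\<^esub> = carrier R"
  and ideals_set_mult [simp]: "A \<otimes>\<^bsub>ideals_set R\<^esub> B = A \<cdot> B"
  by (simp_all add: ideals_set_def)

lemma ideal_pow_0: "ideal_pow R I 0 = carrier R"
  by (simp add: nat_pow_def ideals_set_def)

lemma ideal_pow_Suc: "ideal_pow R I (Suc k) = ideal_pow R I k \<cdot> I"
  by (simp add: nat_pow_def ideals_set_def)

lemma ideal_ideal_pow:
  assumes "ideal I R"
  shows "ideal (ideal_pow R I k) R"
  by (induction k) (auto simp: ideal_pow_0 ideal_pow_Suc oneideal ideal_prod_is_ideal assms)

lemma ideal_pow_Suc_left: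
  assumes "ideal I R"
  shows "ideal_pow R I (Suc k) = I \<cdot> ideal_pow R I k"
  using ideal_prod_commute[OF assms ideal_ideal_pow[OF assms]] by (simp add: ideal_pow_Suc)

lemma ideal_prod_mono:
  assumes "A \<subseteq> A'" "B \<subseteq> B'"
  shows "A \<cdot> B \<subseteq> A' \<cdot> B'"
proof
  fix s assume "s \<in> A \<cdot> B"
  then show "s \<in> A' \<cdot> B'"
    by induction (use assms in \<open>auto intro: ideal_prod.intros\<close>)
qed

lemma ideal_prod_subsetI:
  assumes "ideal C R" "\<And>a b. \<lbrakk>a \<in> A; b \<in> B\<rbrakk> \<Longrightarrow> a \<otimes> b \<in> C"
  shows "A \<cdot> B \<subseteq> C"
proof
  interpret C: ideal C R by fact
  fix s assume "s \<in> A \<cdot> B"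
  then show "s \<in> C" by induction (use assms in auto)
qed

lemma ideal_pow_mono: "A \<subseteq> B \<Longrightarrow> ideal_pow R A k \<subseteq> ideal_pow R B k"
  by (induction k) (auto simp: ideal_pow_0 ideal_pow_Suc dest: ideal_prod_mono subsetD)

lemma ideal_pow_Suc_subset:
  assumes "ideal I R"
  shows "ideal_pow R I (Suc k) \<subseteq> ideal_pow R I k"
  using ideal_prod_inter[OF ideal_ideal_pow[OF assms] assms] by (simp add: ideal_pow_Suc)

lemma pow_mem_ideal_pow: "a \<in> I \<Longrightarrow> a [^] k \<in> ideal_pow R I k"
  by (induction k) (auto simp: ideal_pow_0 ideal_pow_Suc intro: ideal_prod.prod)

lemma maximalideal_quot_length:
  assumes "maximalideal m R"
  shows "quot_length R (carrier R) m \<le> 1"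
proof -
  interpret maximalideal m R by fact
  have "chain_length (ideals_between R m (carrier R)) \<le> 1"
  proof (rule chain_length_least, rule ccontr)
    fix l C
    assume C: "\<And>i. i \<le> l \<Longrightarrow> C i \<in> ideals_between R m (carrier R)"
        "\<And>i. i < l \<Longrightarrow> C i \<subset> C (Suc i)"
      and "\<not> enat l \<le> 1"
    then have l: "2 \<le> l" by (simp add: one_enat_def)
    have "C i = m \<or> C i = carrier R" if "i \<le> l" for i
      using C(1)[OF that] I_maximal unfolding ideals_between_def by auto
    from this[of 0] this[of 1] this[of 2] show False
      using l C(2)[of 0] C(2)[of 1] C(1)[of 0] C(1)[of 1] C(1)[of 2]
      by (auto simp: ideals_between_def numeral_2_eq_2)
  qed
  then show ?thesis by (simp add: quot_length_eq_chain_length is_ideal oneideal a_subset)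
qed

text \<open>Take \<open>A\<close> maximal among the ideals above \<open>I\<close> of infinite
  colength. If \<open>A\<close> contains \<open>m\<close>, then A = m has colength at most 1.
  Otherwise some a \<in> m lies outside \<open>A\<close>; the ideals A + (a) and (A : a) are
  strictly larger, hence of finite colength, and (A + (a))/A is isomorphic to R/(A : a), a
  contradiction.\<close>

lemma noetherian_quot_length_finite:
  assumes "noetherian_ring R" and m: "maximalideal m R" and I: "ideal I R"
    and nil: "\<And>a. a \<in> m \<Longrightarrow> \<exists>k::nat. a [^] k \<in> I"
  shows "quot_length R (carrier R) I \<noteq> \<infinity>"
proof
  interpret N: noetherian_ring R by fact
  interpret m: maximalideal m R by fact
  let ?ql = "quot_length R (carrier R)"
  define S where "S = {A. ideal A R \<and> I \<subseteq> A \<and> ?ql A = \<infinity>}"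
  assume "?ql I = \<infinity>"
  then have IS: "I \<in> S" using I unfolding S_def by simp
  have "\<exists>M\<in>S. \<forall>X\<in>S. M \<subseteq> X \<longrightarrow> X = M"
  proof (rule subset_Zorn)
    fix C assume C: "subset.chain S C"
    show "\<exists>U\<in>S. \<forall>X\<in>C. X \<subseteq> U"
    proof (cases "C = {}")
      case False
      have "subset.chain {I. ideal I R} C"
        using C unfolding pred_on.chain_def S_def by auto
      then have "\<Union>C \<in> C" using N.ideal_chain_is_trivial[OF False] by simp
      moreover have "C \<subseteq> S" using C unfolding pred_on.chain_def by simp
      ultimately show ?thesis by (intro bexI[of _ "\<Union>C"]) auto
    qed (use IS in auto)
  qed
  then obtain A where AS: "A \<in> S" and max: "\<And>X. \<lbrakk>X \<in> S; A \<subseteq> X\<rbrakk> \<Longrightarrow> X = A" by blast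
  then have A: "ideal A R" "I \<subseteq> A" "?ql A = \<infinity>" unfolding S_def by auto
  interpret A: ideal A R by fact
  have larger: "?ql X \<noteq> \<infinity>" if "ideal X R" "A \<subset> X" for X
    using max[of X] that A unfolding S_def by auto
  have ne: "A \<noteq> carrier R" using A(3) quot_length_self[OF oneideal] by auto
  show False
  proof (cases "m \<subseteq> A")
    case True
    then have "A = m" using m.I_maximal[OF A(1)] ne A.a_subset by auto
    then show False using maximalideal_quot_length[OF m] A(3) by simp
  next
    case False
    then obtain a where a: "a \<in> m" "a \<notin> A" by auto
    then have ac: "a \<in> carrier R" using m.Icarr by simp
    define B where "B = {r \<otimes> a \<oplus> b | r b. r \<in> carrier R \<and> b \<in> A}"
    define E where "E = {r \<in> carrier R. r \<otimes> a \<in> A}"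
    have B: "ideal B R" and E: "ideal E R"
      unfolding B_def E_def using ac A by (auto intro!: ideal_mult_add ideal_preimage_mult oneideal)
    interpret B: ideal B R by (fact B)
    have AB: "A \<subseteq> B"
    proof
      fix b assume b: "b \<in> A"
      then have "b = \<zero> \<otimes> a \<oplus> b" using ac A.Icarr by simp
      then show "b \<in> B" unfolding B_def using b by blast
    qed
    have aB: "r \<otimes> a \<in> B" if "r \<in> carrier R" for r
    proof -
      have "r \<otimes> a = r \<otimes> a \<oplus> \<zero>" using that ac by simp
      then show ?thesis unfolding B_def using that A.zero_closed by blast
    qed
    then have "a \<in> B" using aB[OF one_closed] ac by simp
    then have "?ql B \<noteq> \<infinity>" using larger[OF B] AB a by blast
    moreover have "?ql E \<noteq> \<infinity>"
    proof (rule larger[OF E])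
      \<comment> \<open>The last power of \<open>a\<close> outside \<open>A\<close> witnesses that
        (A : a) is strictly larger than \<open>A\<close>.\<close>
      define k where "k = (LEAST k::nat. a [^] k \<in> A)"
      have "\<exists>k::nat. a [^] k \<in> A" using nil[OF a(1)] A(2) by blast
      then have k: "a [^] k \<in> A" unfolding k_def by (rule LeastI_ex)
      then have "k \<noteq> 0" using ne A.one_imp_carrier by (intro notI) simp
      then obtain j where j: "k = Suc j" by (cases k) auto
      have "a [^] j \<notin> A" using not_less_Least[of j "\<lambda>k. a [^] k \<in> A"] j unfolding k_def by auto
      moreover have "a [^] j \<in> E" unfolding E_def using k ac unfolding j by simp
      moreover have "A \<subseteq> E" unfolding E_def using A.I_r_closed ac A.Icarr by auto
      ultimately show "A \<subset> E" by blast
    qed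
    moreover have "quot_length R B A = ?ql E"
    proof -
      have BA: "\<exists>r\<in>carrier R. \<exists>b\<in>A. d = r \<otimes> a \<oplus> b" if "d \<in> B" for d
        using that unfolding B_def by blast
      show ?thesis
        unfolding E_def by (rule quot_length_mult[OF oneideal A(1) B ac AB aB BA])
    qed
    moreover have "?ql A = ?ql B + quot_length R B A"
      using B.Icarr by (intro quot_length_add oneideal A(1) B AB subsetI)
    ultimately show False using A(3) by auto
  qed
qed

text \<open>The regularity conditions for the sequence a, b, written elementwise. The ideal (a, b)
  may be all of R, so that inductions on exponents can start at exponent 0.\<close>

definition regular_pair :: "'a \<Rightarrow> 'a \<Rightarrow> bool" where
  "regular_pair a b \<longleftrightarrow> a \<in> carrier R \<and> b \<in> carrier R \<and>
     (\<forall>r\<in>carrier R. r \<otimes> a = \<zero> \<longrightarrow> r = \<zero>) \<and>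
     (\<forall>r\<in>carrier R. \<forall>s\<in>carrier R. r \<otimes> b = s \<otimes> a \<longrightarrow> (\<exists>t\<in>carrier R. r = t \<otimes> a))"

lemma
  assumes "regular_pair a b"
  shows regular_pair_carr: "a \<in> carrier R" "b \<in> carrier R"
    and regular_pair_fst: "\<lbrakk>r \<in> carrier R; r \<otimes> a = \<zero>\<rbrakk> \<Longrightarrow> r = \<zero>"
    and regular_pair_snd: "\<lbrakk>r \<in> carrier R; s \<in> carrier R; r \<otimes> b = s \<otimes> a\<rbrakk>
      \<Longrightarrow> \<exists>t\<in>carrier R. r = t \<otimes> a"
  using assms unfolding regular_pair_def by blast+

lemma regular_sequence_imp_regular_pair:
  assumes "regular_sequence R [a, b]"
  shows "regular_pair a b"
proof -
  have ab: "a \<in> carrier R" "b \<in> carrier R" using assms unfolding regular_sequence_def by auto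
  have reg: "\<And>i r. \<lbrakk>i < 2; r \<in> carrier R; r \<otimes> [a, b] ! i \<in> Idl (set (take i [a, b]))\<rbrakk>
      \<Longrightarrow> r \<in> Idl (set (take i [a, b]))"
    using assms unfolding regular_sequence_def by auto
  have "Idl {} = {\<zero>}"
    using genideal_minimal[OF zeroideal, of "{}"] genideal_ideal[of "{}"]
    by (auto simp: additive_subgroup.zero_closed ideal.axioms(1))
  moreover have "Idl {a} = PIdl a" using cgenideal_eq_genideal[OF ab(1)] by simp
  ultimately show ?thesis
    unfolding regular_pair_def using reg[of 0] reg[of 1] ab by (auto simp: cgenideal_def) blast
qed

text \<open>Powers of \<open>a\<close> are divided out one factor at a time: regularity of
  \<open>b\<close> modulo \<open>a\<close> gives r = r'a, the factor \<open>a\<close> is cancelled,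
  and the induction hypothesis handles r'.\<close>

lemma regular_pair_pow_left:
  assumes "regular_pair a b"
  shows "regular_pair (a [^] (k::nat)) b"
proof (induction k)
  case 0
  then show ?case using assms by (auto simp: regular_pair_def)
next
  case (Suc k)
  note ab = regular_pair_carr[OF assms]
  have 1: "r = \<zero>" if "r \<in> carrier R" "r \<otimes> a [^] Suc k = \<zero>" for r
  proof -
    have "(r \<otimes> a [^] k) \<otimes> a = \<zero>" using that ab by (simp add: m_assoc)
    moreover have "r \<otimes> a [^] k \<in> carrier R" using that(1) ab by simp
    ultimately have "r \<otimes> a [^] k = \<zero>" by (rule regular_pair_fst[OF assms, rotated])
    then show ?thesis by (rule regular_pair_fst[OF Suc that(1)])
  qed
  have 2: "\<exists>t\<in>carrier R. r = t \<otimes> a [^] Suc k"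
    if rs: "r \<in> carrier R" "s \<in> carrier R" "r \<otimes> b = s \<otimes> a [^] Suc k" for r s
  proof -
    have "r \<otimes> b = (s \<otimes> a [^] k) \<otimes> a" using rs ab by (simp add: m_assoc)
    then obtain r' where r': "r' \<in> carrier R" "r = r' \<otimes> a"
      using regular_pair_snd[OF assms rs(1), of "s \<otimes> a [^] k"] rs(2) ab by auto
    have "(r' \<otimes> b \<ominus> s \<otimes> a [^] k) \<otimes> a = r' \<otimes> a \<otimes> b \<ominus> s \<otimes> (a [^] k \<otimes> a)"
      using rs(1,2) r'(1) ab nat_pow_closed[OF ab(1), of k] by algebra
    also have "\<dots> = \<zero>" using rs ab unfolding r'(2)[symmetric] by simp
    finally have "(r' \<otimes> b \<ominus> s \<otimes> a [^] k) \<otimes> a = \<zero>" .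
    moreover have "r' \<otimes> b \<ominus> s \<otimes> a [^] k \<in> carrier R" using rs(2) r'(1) ab by simp
    ultimately have "r' \<otimes> b \<ominus> s \<otimes> a [^] k = \<zero>" by (rule regular_pair_fst[OF assms, rotated])
    then have "r' \<otimes> b = s \<otimes> a [^] k" using rs(2) r'(1) ab by (simp add: r_right_minus_eq)
    then obtain t where t: "t \<in> carrier R" "r' = t \<otimes> a [^] k"
      using regular_pair_snd[OF Suc r'(1) rs(2)] by blast
    then have "r = t \<otimes> a [^] Suc k" using r' ab by (simp add: m_assoc)
    then show ?thesis using t by blast
  qed
  show ?case unfolding regular_pair_def using 1 2 ab by auto
qed

lemma regular_pair_pow_right:
  assumes "regular_pair a b"
  shows "regular_pair a (b [^] (k::nat))"
proof (induction k)
  case 0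
  then show ?case using assms by (auto simp: regular_pair_def)
next
  case (Suc k)
  note ab = regular_pair_carr[OF assms]
  have "\<exists>t\<in>carrier R. r = t \<otimes> a"
    if rs: "r \<in> carrier R" "s \<in> carrier R" "r \<otimes> b [^] Suc k = s \<otimes> a" for r s
  proof -
    have "(r \<otimes> b) \<otimes> b [^] k = s \<otimes> a" using rs ab nat_pow_Suc2[of b k] by (simp add: m_assoc)
    then obtain t where "t \<in> carrier R" "r \<otimes> b = t \<otimes> a"
      using regular_pair_snd[OF Suc, of "r \<otimes> b" s] rs ab by auto
    then show ?thesis using regular_pair_snd[OF assms rs(1)] by blast
  qed
  then show ?case using assms unfolding regular_pair_def by simp
qed

text \<open>The homology of the Koszul complex of \<open>x, y\<close> is killed by the ideal \<open>(x, y)\<close>, which contains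
  a regular sequence.\<close>

lemma regular_pair_imp_acyclic_pair:
  assumes reg: "regular_pair a b" and xy: "x \<in> carrier R" "y \<in> carrier R"
    and "a \<in> Idl {x, y}" "b \<in> Idl {x, y}"
  shows "acyclic_pair R x y"
proof
  fix p q assume p: "p \<in> carrier R" and q: "q \<in> carrier R" and pq: "p \<otimes> x \<oplus> q \<otimes> y = \<zero>"
  obtain \<alpha> \<beta> where a: "\<alpha> \<in> carrier R" "\<beta> \<in> carrier R" "a = \<alpha> \<otimes> x \<oplus> \<beta> \<otimes> y"
    using assms by (auto simp: mem_Idl_pair_iff)
  obtain \<gamma> \<delta> where b: "\<gamma> \<in> carrier R" "\<delta> \<in> carrier R" "b = \<gamma> \<otimes> x \<oplus> \<delta> \<otimes> y"
    using assms by (auto simp: mem_Idl_pair_iff)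
  have regD: "r = \<zero>" if "r \<in> carrier R" "r \<otimes> a = \<zero>" for r
    using regular_pair_fst[OF reg] that .
  have ab: "a \<in> carrier R" "b \<in> carrier R" using a b xy by auto
  \<comment> \<open>\<open>s\<close> and \<open>t\<close> are the values at (p, q) of the homotopies
    by which \<open>a\<close> and \<open>b\<close> annihilate Koszul homology: a(p, q) = s(-y, x)
    and b(p, q) = t(-y, x).\<close>
  define s where "s = \<alpha> \<otimes> q \<ominus> \<beta> \<otimes> p"
  define t where "t = \<gamma> \<otimes> q \<ominus> \<delta> \<otimes> p"
  have st: "s \<in> carrier R" "t \<in> carrier R" using a b p q unfolding s_def t_def by auto
  have px: "p \<otimes> x = \<ominus> (q \<otimes> y)" using pq p q xy by (simp add: minus_equality)
  have ap: "a \<otimes> p = \<ominus> (s \<otimes> y)"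
  proof -
    have "a \<otimes> p = \<alpha> \<otimes> (p \<otimes> x) \<oplus> \<beta> \<otimes> y \<otimes> p" unfolding a(3) using a(1,2) p xy by algebra
    also have "\<dots> = \<ominus> (s \<otimes> y)" unfolding px s_def using a(1,2) p q xy by algebra
    finally show ?thesis .
  qed
  have aq: "a \<otimes> q = s \<otimes> x"
  proof -
    have "s \<otimes> x = \<alpha> \<otimes> q \<otimes> x \<ominus> \<beta> \<otimes> (p \<otimes> x)" unfolding s_def using a(1,2) p q xy by algebra
    also have "\<dots> = a \<otimes> q" unfolding px a(3) using a(1,2) p q xy by algebra
    finally show ?thesis by simp
  qed
  have bp: "b \<otimes> p = \<ominus> (t \<otimes> y)"
  proof -
    have "b \<otimes> p = \<gamma> \<otimes> (p \<otimes> x) \<oplus> \<delta> \<otimes> y \<otimes> p" unfolding b(3) using b(1,2) p xy by algebra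
    also have "\<dots> = \<ominus> (t \<otimes> y)" unfolding px t_def using b(1,2) p q xy by algebra
    finally show ?thesis .
  qed
  have bq: "b \<otimes> q = t \<otimes> x"
  proof -
    have "t \<otimes> x = \<gamma> \<otimes> q \<otimes> x \<ominus> \<delta> \<otimes> (p \<otimes> x)" unfolding t_def using b(1,2) p q xy by algebra
    also have "\<dots> = b \<otimes> q" unfolding px b(3) using b(1,2) p q xy by algebra
    finally show ?thesis by simp
  qed
  \<comment> \<open>Computing ab(p, q) in both ways shows that sb - ta is killed by x and y, hence
    by a \<in> (x, y), and so it is zero.\<close>
  have "(s \<otimes> b \<ominus> t \<otimes> a) \<otimes> x = \<zero>"
  proof -
    have "(s \<otimes> b \<ominus> t \<otimes> a) \<otimes> x = b \<otimes> (s \<otimes> x) \<ominus> a \<otimes> (t \<otimes> x)" using st ab xy by algebra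
    also have "\<dots> = b \<otimes> (a \<otimes> q) \<ominus> a \<otimes> (b \<otimes> q)" unfolding aq bq ..
    also have "\<dots> = \<zero>" using ab q by algebra
    finally show ?thesis .
  qed
  moreover have "(s \<otimes> b \<ominus> t \<otimes> a) \<otimes> y = \<zero>"
  proof -
    have "(s \<otimes> b \<ominus> t \<otimes> a) \<otimes> y = a \<otimes> (\<ominus> (t \<otimes> y)) \<ominus> b \<otimes> (\<ominus> (s \<otimes> y))" using st ab xy by algebra
    also have "\<dots> = a \<otimes> (b \<otimes> p) \<ominus> b \<otimes> (a \<otimes> p)" unfolding ap bp ..
    also have "\<dots> = \<zero>" using ab p by algebra
    finally show ?thesis .
  qed
  moreover have "(s \<otimes> b \<ominus> t \<otimes> a) \<otimes> a
      = \<alpha> \<otimes> ((s \<otimes> b \<ominus> t \<otimes> a) \<otimes> x) \<oplus> \<beta> \<otimes> ((s \<otimes> b \<ominus> t \<otimes> a) \<otimes> y)"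
  proof -
    have "w \<otimes> a = \<alpha> \<otimes> (w \<otimes> x) \<oplus> \<beta> \<otimes> (w \<otimes> y)" if "w \<in> carrier R" for w
      unfolding a(3) using that a(1,2) xy by algebra
    from this[of "s \<otimes> b \<ominus> t \<otimes> a"] show ?thesis using st ab by blast
  qed
  ultimately have "(s \<otimes> b \<ominus> t \<otimes> a) \<otimes> a = \<zero>" using a by simp
  then have "s \<otimes> b \<ominus> t \<otimes> a = \<zero>" by (rule regD[rotated]) (use st ab in simp)
  then have "s \<otimes> b = t \<otimes> a" using st ab by (simp add: r_right_minus_eq)
  \<comment> \<open>Regularity of \<open>b\<close> modulo \<open>a\<close> gives s = ua; it remains
    to cancel \<open>a\<close> in a(p, q) = ua(-y, x).\<close>
  then obtain u where u: "u \<in> carrier R" "s = u \<otimes> a"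
    using regular_pair_snd[OF reg st] by blast
  have "(p \<oplus> u \<otimes> y) \<otimes> a = a \<otimes> p \<oplus> s \<otimes> y" unfolding u(2) using u(1) p ab xy by algebra
  then have "(p \<oplus> u \<otimes> y) \<otimes> a = \<zero>" using ap st xy by (simp add: l_neg)
  then have "p \<oplus> u \<otimes> y = \<zero>" by (rule regD[rotated]) (use p u xy in simp)
  then have "p = \<ominus> (u \<otimes> y)" using p u xy by (simp add: minus_equality)
  moreover have "(q \<ominus> u \<otimes> x) \<otimes> a = a \<otimes> q \<ominus> s \<otimes> x" unfolding u(2) using u(1) q ab xy by algebra
  then have "(q \<ominus> u \<otimes> x) \<otimes> a = \<zero>" using aq st xy by (simp add: r_right_minus_eq)
  then have "q \<ominus> u \<otimes> x = \<zero>" by (rule regD[rotated]) (use q u xy in simp)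
  then have "q = u \<otimes> x" using q u xy by (simp add: r_right_minus_eq)
  ultimately show "\<exists>u\<in>carrier R. p = \<ominus> (u \<otimes> y) \<and> q = u \<otimes> x" using u by blast
qed (use xy in auto)

end

section \<open>Growth of the powers of J\<close>

context acyclic_pair
begin

abbreviation Jpow :: "nat \<Rightarrow> 'a set" where "Jpow n \<equiv> ideal_pow R J n"

lemma x_mem: "x \<in> J" and y_mem: "y \<in> J"
  using genideal_self[of "{x, y}"] x_carr y_carr by auto

lemma Jpow_ideal: "ideal (Jpow n) R"
  by (rule ideal_ideal_pow[OF J_ideal])

text \<open>Among the monomials of degree n + 1 in x and y only y^(n+1) is not divisible by x. Thus
  J^(n+1) modulo x J^n is generated by y^(n+1).\<close>

lemma Jpow_Suc_expand:
  assumes "d \<in> Jpow (Suc n)"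
  shows "\<exists>r\<in>Jpow n. \<exists>s\<in>carrier R. d = r \<otimes> x \<oplus> s \<otimes> y [^] Suc n"
  using assms
proof (induction n arbitrary: d)
  case 0
  then have "d \<in> J \<cdot> carrier R" using ideal_prod_commute[OF oneideal J_ideal] by simp
  then show ?case
    using x_carr y_carr by (auto simp: mem_Idl_pair_prod_iff oneideal ideal_pow_0)
next
  case (Suc n)
  interpret P: ideal "Jpow n" R by (rule Jpow_ideal)
  interpret Q: ideal "Jpow (Suc n)" R by (rule Jpow_ideal)
  have "d \<in> J \<cdot> Jpow (Suc n)"
    using Suc.prems by (simp only: ideal_pow_Suc_left[OF J_ideal, of "Suc n"])
  then obtain p q where pq: "p \<in> Jpow (Suc n)" "q \<in> Jpow (Suc n)" "d = p \<otimes> x \<oplus> q \<otimes> y"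
    unfolding mem_Idl_pair_prod_iff[OF x_carr y_carr Jpow_ideal] by blast
  obtain r s where rs: "r \<in> Jpow n" "s \<in> carrier R" "q = r \<otimes> x \<oplus> s \<otimes> y [^] Suc n"
    using Suc.IH[OF pq(2)] by blast
  have "r \<otimes> y \<in> Jpow (Suc n)" using rs(1) y_mem by (simp add: ideal_pow_Suc ideal_prod.prod)
  then have "p \<oplus> r \<otimes> y \<in> Jpow (Suc n)" by (rule Q.a_closed[OF pq(1)])
  moreover have "d = (p \<oplus> r \<otimes> y) \<otimes> x \<oplus> s \<otimes> (y [^] Suc n \<otimes> y)"
    unfolding pq(3) rs(3)
    using rs(2) P.Icarr[OF rs(1)] Q.Icarr[OF pq(1)] x_carr y_carr nat_pow_closed[OF y_carr, of "Suc n"]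
    by algebra
  ultimately show ?case using rs(2) nat_pow_Suc[of y "Suc n"] by metis
qed

text \<open>Cut J^(n+1)/J^(n+2) at X = x J^n + J^(n+2). The upper part is generated by y^(n+1) and
  killed by J, so its length is at most \<lambda>(R/J). The lower part is an image of J^n/J^(n+1)
  under multiplication by x.\<close>

lemma quot_length_Jpow_Suc:
  "quot_length R (Jpow n) (Jpow (Suc n)) \<le> enat (Suc n) * quot_length R (carrier R) J"
proof (induction n)
  case 0
  have "Jpow (Suc 0) = J"
    using ideal_prod_commute[OF oneideal J_ideal] ideal_prod_one[OF J_ideal] by simp
  moreover have "enat (Suc 0) = 1" by (simp add: one_enat_def)
  ultimately show ?case by (simp only: ideal_pow_0 mult_1 order_refl)
next
  case (Suc n)
  define B where "B = Jpow (Suc (Suc n))"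
  define X where "X = {r \<otimes> x \<oplus> b | r b. r \<in> Jpow n \<and> b \<in> B}"
  have B: "ideal B R" unfolding B_def by (rule Jpow_ideal)
  have X: "ideal X R" unfolding X_def by (intro ideal_mult_add Jpow_ideal B x_carr)
  interpret B: ideal B R by (fact B)
  interpret X: ideal X R by (fact X)
  interpret P: ideal "Jpow n" R by (rule Jpow_ideal)
  interpret Q: ideal "Jpow (Suc n)" R by (rule Jpow_ideal)
  have BX: "B \<subseteq> X"
  proof
    fix b assume b: "b \<in> B"
    then have "b = \<zero> \<otimes> x \<oplus> b" using x_carr B.Icarr by simp
    then show "b \<in> X" unfolding X_def using b P.zero_closed by blast
  qed
  have BQ: "B \<subseteq> Jpow (Suc n)" unfolding B_def by (rule ideal_pow_Suc_subset[OF J_ideal])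
  have rx: "r \<otimes> x \<in> Jpow (Suc k)" if "r \<in> Jpow k" for r k
    using that x_mem by (simp add: ideal_pow_Suc ideal_prod.prod)
  have XQ: "X \<subseteq> Jpow (Suc n)" unfolding X_def using rx BQ Q.a_closed by blast
  have rX: "r \<otimes> x \<in> X" if "r \<in> Jpow n" for r
  proof -
    have "r \<otimes> x = r \<otimes> x \<oplus> \<zero>" using that P.Icarr x_carr by simp
    then show ?thesis unfolding X_def using that B.zero_closed by blast
  qed
  have "quot_length R (Jpow (Suc n)) X
      = quot_length R (carrier R) {r \<in> carrier R. r \<otimes> y [^] Suc n \<in> X}"
  proof (rule quot_length_mult[OF oneideal X Jpow_ideal _ XQ])
    show "r \<otimes> y [^] Suc n \<in> Jpow (Suc n)" if "r \<in> carrier R" for r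
      using that pow_mem_ideal_pow[OF y_mem] Q.I_l_closed by blast
    show "\<exists>r\<in>carrier R. \<exists>b\<in>X. d = r \<otimes> y [^] Suc n \<oplus> b" if d: "d \<in> Jpow (Suc n)" for d
    proof -
      obtain r s where rs: "r \<in> Jpow n" "s \<in> carrier R" "d = r \<otimes> x \<oplus> s \<otimes> y [^] Suc n"
        using Jpow_Suc_expand[OF d] by blast
      then have "d = s \<otimes> y [^] Suc n \<oplus> r \<otimes> x"
        using P.Icarr x_carr y_carr by (simp add: a_comm del: nat_pow_Suc)
      then show ?thesis using rs rX by blast
    qed
  qed (use y_carr in auto)
  also have "\<dots> \<le> quot_length R (carrier R) J"
  proof (rule quot_length_anti[OF oneideal J_ideal])
    show "ideal {r \<in> carrier R. r \<otimes> y [^] Suc n \<in> X} R"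
      using y_carr by (intro ideal_preimage_mult oneideal X) auto
    show "J \<subseteq> {r \<in> carrier R. r \<otimes> y [^] Suc n \<in> X}"
    proof
      fix r assume r: "r \<in> J"
      then have "r \<otimes> y [^] Suc n \<in> B"
        unfolding B_def using pow_mem_ideal_pow[OF y_mem, of "Suc n"]
        by (subst ideal_pow_Suc_left[OF J_ideal]) (rule ideal_prod.prod)
      then show "r \<in> {r \<in> carrier R. r \<otimes> y [^] Suc n \<in> X}" using BX r J_subset by auto
    qed
  qed auto
  finally have 1: "quot_length R (Jpow (Suc n)) X \<le> quot_length R (carrier R) J" .
  have "quot_length R X B = quot_length R (Jpow n) {r \<in> Jpow n. r \<otimes> x \<in> B}"
    by (rule quot_length_mult[OF Jpow_ideal B X x_carr BX rX]) (auto simp: X_def)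
  also have "\<dots> \<le> quot_length R (Jpow n) (Jpow (Suc n))"
  proof (rule quot_length_anti[OF Jpow_ideal Jpow_ideal])
    show "ideal {r \<in> Jpow n. r \<otimes> x \<in> B} R" by (intro ideal_preimage_mult Jpow_ideal B x_carr)
    show "Jpow (Suc n) \<subseteq> {r \<in> Jpow n. r \<otimes> x \<in> B}"
      using rx ideal_pow_Suc_subset[OF J_ideal, of n] unfolding B_def by blast
  qed auto
  also have "\<dots> \<le> enat (Suc n) * quot_length R (carrier R) J" by (rule Suc.IH)
  finally have 2: "quot_length R X B \<le> enat (Suc n) * quot_length R (carrier R) J" .
  have "quot_length R (Jpow (Suc n)) B = quot_length R (Jpow (Suc n)) X + quot_length R X B"
    by (rule quot_length_add[OF Jpow_ideal B X BX XQ])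
  also have "\<dots> \<le> quot_length R (carrier R) J + enat (Suc n) * quot_length R (carrier R) J"
    by (rule add_mono[OF 1 2])
  also have "\<dots> = enat (Suc (Suc n)) * quot_length R (carrier R) J"
    by (simp add: eSuc_enat[symmetric] mult_eSuc)
  finally show ?case unfolding B_def .
qed

lemma quot_length_Jpow:
  "quot_length R (carrier R) (Jpow n) \<le> enat (Suc n choose 2) * quot_length R (carrier R) J"
proof (induction n)
  case 0
  then show ?case using quot_length_self[OF oneideal] by (simp add: ideal_pow_0)
next
  case (Suc n)
  have "quot_length R (carrier R) (Jpow (Suc n))
      = quot_length R (carrier R) (Jpow n) + quot_length R (Jpow n) (Jpow (Suc n))"
    using ideal_pow_Suc_subset[OF J_ideal] ideal.Icarr[OF Jpow_ideal]
    by (intro quot_length_add oneideal Jpow_ideal subsetI) blast+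
  also have "\<dots> \<le> enat (Suc n choose 2) * quot_length R (carrier R) J
      + enat (Suc n) * quot_length R (carrier R) J"
    by (rule add_mono[OF Suc quot_length_Jpow_Suc])
  also have "\<dots> = enat (Suc (Suc n) choose 2) * quot_length R (carrier R) J"
    by (simp add: distrib_right[symmetric] numeral_2_eq_2 ac_simps)
  finally show ?case .
qed

end

text \<open>The supremum defining the depth is attained: otherwise every regular sequence in
  \<open>m\<close> would have length at most 1.\<close>

lemma (in cring) depth_two_regular_pair:
  assumes "ring_depth R m = 2"
  obtains a b where "a \<in> m" "b \<in> m" "regular_pair a b"
proof -
  have "\<exists>xs. set xs \<subseteq> m \<and> regular_sequence R xs \<and> 2 \<le> length xs"
  proof (rule ccontr)
    assume *: "\<not> ?thesis"
    have "ring_depth R m \<le> enat 1"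
      unfolding ring_depth_def
    proof (rule Sup_least)
      fix l assume "l \<in> {enat (length xs) | xs. set xs \<subseteq> m \<and> regular_sequence R xs}"
      then obtain xs where "l = enat (length xs)" "set xs \<subseteq> m" "regular_sequence R xs" by blast
      then show "l \<le> enat 1" using * by fastforce
    qed
    then show False using assms by (simp add: numeral_eq_enat)
  qed
  then obtain xs where xs: "set xs \<subseteq> m" "regular_sequence R xs" "2 \<le> length xs" by blast
  then have "enat (length xs) \<le> ring_depth R m"
    unfolding ring_depth_def by (intro Sup_upper) blast
  then have "length xs = 2" using assms xs(3) by (simp add: numeral_eq_enat)
  then obtain a b where "xs = [a, b]"
    by (auto simp: length_Suc_conv numeral_2_eq_2)
  then show thesis using xs by (intro that[of a b] regular_sequence_imp_regular_pair) auto
qed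

section \<open>Hilbert polynomials\<close>

lemma poly2_Suc: "poly2 (c0, c1, c2) (Suc n) = poly2 (c0, c1, c2) n + c0 * (int n + 1) - c1"
  by (simp add: poly2_def numeral_2_eq_2 algebra_simps)

text \<open>This discharges the description operator. First differences at two consecutive arguments
  determine \<open>c0\<close> and \<open>c1\<close>, and one value then determines
  \<open>c2\<close>.\<close>

lemma poly2_coeffs_eqI:
  assumes "\<forall>\<^sub>F n in sequentially. f n = poly2 c n"
  shows "poly2_coeffs f = c"
  unfolding poly2_coeffs_def
proof (rule the_equality[of "\<lambda>c. \<forall>\<^sub>F n in sequentially. f n = poly2 c n", OF assms])
  fix d assume "\<forall>\<^sub>F n in sequentially. f n = poly2 d n"
  with assms have "\<forall>\<^sub>F n in sequentially. poly2 c n = poly2 d n"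
    by eventually_elim simp
  then obtain N where N: "\<And>n. n \<ge> N \<Longrightarrow> poly2 c n = poly2 d n"
    by (auto simp: eventually_sequentially)
  obtain c0 c1 c2 d0 d1 d2 where cd: "c = (c0, c1, c2)" "d = (d0, d1, d2)"
    by (metis prod.collapse)
  have 1: "c0 * (int n + 1) - c1 = d0 * (int n + 1) - d1" if "n \<ge> N" for n
    using N[OF that] N[of "Suc n"] that unfolding cd poly2_Suc by simp
  have "c0 = d0" using 1[of N] 1[of "Suc N"] by (simp add: algebra_simps)
  moreover from this have "c1 = d1" using 1[of N] by simp
  ultimately show "d = c" using N[of N] unfolding cd by (simp add: poly2_def)
qed

lemma second_diff_const_imp_poly2:
  assumes "\<And>n. n \<ge> N \<Longrightarrow> f (n + 2) - 2 * f (n + 1) + f n = c0"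
  shows "\<exists>c1 c2. \<forall>n\<ge>N. f n = poly2 (c0, c1, c2) n"
proof -
  \<comment> \<open>\<open>c1\<close> and \<open>c2\<close> are chosen so that the polynomial
    matches \<open>f\<close> at \<open>N\<close> and \<open>N + 1\<close>; the induction then
    carries two consecutive values.\<close>
  define c1 where "c1 = c0 * (int N + 1) - (f (N + 1) - f N)"
  define c2 where "c2 = f N - poly2 (c0, c1, 0) N"
  have "f n = poly2 (c0, c1, c2) n \<and> f (Suc n) = poly2 (c0, c1, c2) (Suc n)" if "n \<ge> N" for n
    using that
  proof (induction n rule: dec_induct)
    case base
    have "f N = poly2 (c0, c1, c2) N" by (simp add: c2_def poly2_def)
    then show ?case unfolding poly2_Suc by (simp add: c1_def)
  next
    case (step n)
    then show ?case using assms[of n] unfolding poly2_Suc by (simp add: algebra_simps)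
  qed
  then show ?thesis by blast
qed

text \<open>The slope \<open>s\<close> of \<open>G\<close> never increases, and it cannot become
  negative, for then \<open>G\<close> would fall below 0. A nonincreasing sequence of natural
  numbers is eventually constant, and \<open>d\<close> is the drop of the slope. Over the reals the
  drops could go on forever.\<close>

lemma concave_nonneg_eventually_affine:
  fixes G d :: "nat \<Rightarrow> int"
  assumes G: "\<And>n. n \<ge> N \<Longrightarrow> 0 \<le> G n" and d: "\<And>n. n \<ge> N \<Longrightarrow> 0 \<le> d n"
    and diff: "\<And>n. n \<ge> N \<Longrightarrow> G (n + 2) - 2 * G (n + 1) + G n = - d n"
  shows "\<exists>N'\<ge>N. \<forall>n\<ge>N'. d n = 0"
proof -
  define s where "s n = G (Suc n) - G n" for n
  have s_Suc: "s (Suc n) = s n - d n" if "n \<ge> N" for n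
    using diff[OF that] unfolding s_def by simp
  have s_mono: "s n \<le> s k" if "N \<le> k" "k \<le> n" for n k
    using that(2,1)
  proof (induction n rule: dec_induct)
    case (step n)
    then show ?case using s_Suc[of n] d[of n] by simp
  qed simp
  have s_nonneg: "0 \<le> s k" if k: "N \<le> k" for k
  proof (rule ccontr)
    assume neg: "\<not> 0 \<le> s k"
    have "G (k + j) \<le> G k - int j" for j
    proof (induction j)
      case (Suc j)
      have "s (k + j) \<le> s k" by (rule s_mono) (use k in auto)
      then show ?case using Suc neg unfolding s_def by simp
    qed simp
    \<comment> \<open>A negative integer slope loses at least 1 per step, so
      \<open>nat (G k) + 1\<close> steps take \<open>G\<close> below 0.\<close>
    from this[of "nat (G k) + 1"] G[of k] G[of "k + (nat (G k) + 1)"] k show False by simp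
  qed
  obtain k where k: "N \<le> k" and least: "\<And>n. N \<le> n \<Longrightarrow> nat (s k) \<le> nat (s n)"
    using ex_has_least_nat[of "\<lambda>n. N \<le> n" N "\<lambda>n. nat (s n)"] by auto
  have sk: "s n = s k" if "n \<ge> k" for n
    using least[of n] s_mono[OF k that] s_nonneg[of n] s_nonneg[of k] k that by simp
  have "d n = 0" if "n \<ge> k" for n
    using s_Suc[of n] sk[of n] sk[of "Suc n"] that k by linarith
  then show ?thesis using k by blast
qed

text \<open>Summation by parts, with sums over the support standing for infinite series. The
  recursion starts at n = 2, so \<open>v 1\<close> stays free; it has weight 0 in the second
  sum.\<close>

lemma second_diff_finite_sums:
  fixes w :: "nat \<Rightarrow> int"
  assumes w: "\<And>n. n \<ge> N \<Longrightarrow> w n = 0"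
    and v: "\<And>n. n \<ge> 2 \<Longrightarrow> v n = w n - 2 * w (n - 1) + w (n - 2)"
  shows "finite {n. v n \<noteq> 0}"
    and "(\<Sum>n | 1 \<le> n \<and> v n \<noteq> 0. v n) = v 1 + w 0 - w 1"
    and "(\<Sum>n | 1 \<le> n \<and> v n \<noteq> 0. (int n - 1) * v n) = w 0"
proof -
  have v0: "v n = 0" if "n \<ge> N + 2" for n using v[of n] w that by simp
  have sub: "{n. v n \<noteq> 0} \<subseteq> {..<N + 2}" using v0 by (auto simp: not_less[symmetric])
  then show fin: "finite {n. v n \<noteq> 0}" by (rule finite_subset) simp
  \<comment> \<open>In these closed forms the terms at \<open>k\<close> and \<open>k + 1\<close>
    vanish once \<open>k \<ge> N\<close>; only the boundary terms at 0 and 1 survive.\<close>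
  have sums: "(\<Sum>n = 1..k + 1. v n) = v 1 + w (k + 1) - w k - (w 1 - w 0)"
    "(\<Sum>n = 1..k + 1. (int n - 1) * v n) = int k * (w (k + 1) - w k) - w k + w 0" for k
  proof (induction k)
    case (Suc k)
    have vk: "v (Suc (Suc k)) = w (Suc (Suc k)) - 2 * w (Suc k) + w k"
      using v[of "Suc (Suc k)"] by (simp add: numeral_2_eq_2)
    {
      case 1
      then show ?case using Suc(1) by (simp add: vk)
    next
      case 2
      have "(\<Sum>n = 1..Suc k + 1. (int n - 1) * v n)
          = int k * (w (k + 1) - w k) - w k + w 0 + (int k + 1) * v (Suc (Suc k))"
        using Suc(2) by simp
      then show ?case unfolding vk by (simp add: algebra_simps)
    }
  qed simp_all
  have "(\<Sum>n | 1 \<le> n \<and> v n \<noteq> 0. g n * v n) = (\<Sum>n = 1..(N + 1) + 1. g n * v n)" for g :: "nat \<Rightarrow> int"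
    by (rule sum.mono_neutral_left) (use sub in auto)
  from this[of "\<lambda>_. 1"] this[of "\<lambda>n. int n - 1"]
  show "(\<Sum>n | 1 \<le> n \<and> v n \<noteq> 0. v n) = v 1 + w 0 - w 1"
    and "(\<Sum>n | 1 \<le> n \<and> v n \<noteq> 0. (int n - 1) * v n) = w 0"
    using sums[of "N + 1"] w by simp_all
qed

section \<open>Integer lengths and the second difference\<close>

context cring
begin

lemma len_nonneg: "0 \<le> len R A B"
  by (simp add: len_def)

lemma len_add:
  assumes "ideal A R" "ideal B R" "ideal C R" "B \<subseteq> C" "C \<subseteq> A" "quot_length R A B \<noteq> \<infinity>"
  shows "len R A B = len R A C + len R C B"
    and "quot_length R A C \<noteq> \<infinity>" and "quot_length R C B \<noteq> \<infinity>"
  using quot_length_add[OF assms(1-5)] assms(6) unfolding len_def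
  by (cases "quot_length R A C"; cases "quot_length R C B"; simp)+

end

locale parameter_pair = acyclic_pair +
  assumes finite_J: "quot_length R (carrier R) J \<noteq> \<infinity>"
begin

lemma finite_colength:
  assumes "ideal A R" "Jpow n \<subseteq> A"
  shows "quot_length R (carrier R) A \<noteq> \<infinity>"
proof -
  obtain e where "quot_length R (carrier R) J = enat e" using finite_J by auto
  then have "quot_length R (carrier R) A \<le> enat ((Suc n choose 2) * e)"
    using order_trans[OF quot_length_anti[OF oneideal Jpow_ideal assms] quot_length_Jpow]
      ideal.Icarr[OF assms(1)] by auto
  then show ?thesis by (cases "quot_length R (carrier R) A") auto
qed

lemma len_Jpow: "len R (carrier R) (Jpow n) \<le> int (Suc n choose 2) * len R (carrier R) J"
proof -
  obtain e where e: "quot_length R (carrier R) J = enat e" using finite_J by auto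
  obtain l where l: "quot_length R (carrier R) (Jpow n) = enat l"
    using finite_colength[OF Jpow_ideal order_refl] by blast
  have "l \<le> (Suc n choose 2) * e" using quot_length_Jpow[of n] unfolding e l by simp
  then show ?thesis unfolding len_def e l by (simp flip: of_nat_mult)
qed

text \<open>\<lambda>(R/JL) is \<lambda>(R/J) + \<lambda>(J/JL), and the Koszul formula evaluates
  the last term. For consecutive members L and JL of a J-stable filtration this controls a second
  difference of lengths.\<close>

lemma len_J_prod:
  assumes L: "ideal L R" and fin: "quot_length R (carrier R) L \<noteq> \<infinity>"
  shows "quot_length R (carrier R) (J \<cdot> L) \<noteq> \<infinity>"
    and "len R (carrier R) (J \<cdot> L) =
      len R (carrier R) J + 2 * len R (carrier R) L - len R (carrier R) (colon R L J)"
proof -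
  have *: "quot_length R (carrier R) (J \<cdot> L) = quot_length R (carrier R) J + quot_length R J (J \<cdot> L)"
    using ideal_prod_inter[OF J_ideal L]
    by (intro quot_length_add oneideal ideal_prod_is_ideal J_ideal L J_subset) auto
  obtain e l where el: "quot_length R (carrier R) J = enat e" "quot_length R (carrier R) L = enat l"
    using fin finite_J by blast
  obtain a c where ac: "quot_length R J (J \<cdot> L) = enat a"
      "quot_length R (carrier R) (colon R L J) = enat c"
    using quot_length_J_prod_colon[OF L] unfolding el
    by (cases "quot_length R J (J \<cdot> L)"; cases "quot_length R (carrier R) (colon R L J)") auto
  have "a + c = 2 * l" using quot_length_J_prod_colon[OF L] unfolding el ac by simp
  then show "quot_length R (carrier R) (J \<cdot> L) \<noteq> \<infinity>"
    and "len R (carrier R) (J \<cdot> L) =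
      len R (carrier R) J + 2 * len R (carrier R) L - len R (carrier R) (colon R L J)"
    using * unfolding len_def el ac by simp_all
qed

text \<open>The second difference of \<open>\<lambda>(R/M\<^sub>n)\<close> exceeds \<open>\<lambda>(R/J)\<close> by \<open>\<lambda>((M\<^sub>n\<^sub>+\<^sub>1 : J)/M\<^sub>n)\<close>, whereas
  \<open>\<lambda>(R/M\<^sub>n) \<le> \<lambda>(R/J\<^sup>n\<^sup>+\<^sup>1)\<close> grows no faster than a quadratic polynomial with second
  difference \<open>\<lambda>(R/J)\<close>. The excess must therefore vanish for large \<open>n\<close>.\<close>

lemma
  assumes M: "\<And>n. ideal (M n) R" and step: "\<And>n. n \<ge> N \<Longrightarrow> M (Suc n) = J \<cdot> M n"
    and JM: "\<And>n. Jpow (Suc n) \<subseteq> M n"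
  shows eventually_colon_eq: "\<exists>N'\<ge>N. \<forall>n\<ge>N'. colon R (M (Suc n)) J = M n"
    and eventually_len_poly2: "\<exists>c1 c2. \<forall>\<^sub>F n in sequentially.
      len R (carrier R) (M n) = poly2 (len R (carrier R) J, c1, c2) n"
proof -
  define e where "e = len R (carrier R) J"
  define H where "H n = len R (carrier R) (M n)" for n
  define C where "C n = colon R (M (Suc n)) J" for n
  define d where "d n = len R (C n) (M n)" for n
  \<comment> \<open>The shift to \<open>Suc n\<close> comes from \<open>JM\<close>: \<lambda>(R/M n)
    is at most \<lambda>(R/J^(n+1)), which is bounded by \<open>e\<close> times n + 2 choose
    2.\<close>
  define G where "G n = poly2 (e, 0, 0) (Suc n) - H n" for n
  have fin: "quot_length R (carrier R) (M n) \<noteq> \<infinity>" for n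
    by (rule finite_colength[OF M JM])
  have C: "ideal (C n) R" for n unfolding C_def by (intro ideal_colon M J_subset)
  have MC: "M n \<subseteq> C n" if "n \<ge> N" for n
  proof
    fix r assume r: "r \<in> M n"
    then have rc: "r \<in> carrier R" using ideal.Icarr[OF M] by blast
    have "r \<otimes> b \<in> M (Suc n)" if b: "b \<in> J" for b
    proof -
      have "b \<otimes> r \<in> J \<cdot> M n" using b r by (rule ideal_prod.prod)
      then show ?thesis using step[OF \<open>n \<ge> N\<close>] b J_subset rc by (simp add: m_comm subset_iff)
    qed
    then show "r \<in> C n" using rc unfolding C_def colon_def by simp
  qed
  have HC: "H n = len R (carrier R) (C n) + d n" and finC: "quot_length R (C n) (M n) \<noteq> \<infinity>"
    if "n \<ge> N" for n
  proof -
    have "C n \<subseteq> carrier R" using ideal.Icarr[OF C] by blast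
    note * = len_add[OF oneideal M C MC[OF that] this fin]
    show "H n = len R (carrier R) (C n) + d n" "quot_length R (C n) (M n) \<noteq> \<infinity>"
      using *(1,3) unfolding H_def d_def by auto
  qed
  \<comment> \<open>Apply \<open>len_J_prod\<close> to \<open>M (Suc n)\<close>: \<lambda>(R/C n)
    appears where a second difference would have \<open>H n\<close>, and the gap between them is
    \<open>d n\<close>.\<close>
  have H2: "H (n + 2) - 2 * H (n + 1) + H n = e + d n" if "n \<ge> N" for n
    using len_J_prod(2)[OF M[of "Suc n"] fin] step[of "Suc n"] HC[OF that] that
    unfolding H_def e_def C_def by simp
  have "0 \<le> G n" for n
  proof -
    have "H n \<le> len R (carrier R) (Jpow (Suc n))"
      unfolding H_def
      using len_add(1)[OF oneideal Jpow_ideal M JM _ finite_colength[OF Jpow_ideal order_refl]]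
        ideal.Icarr[OF M, of _ n] len_nonneg[of "M n" "Jpow (Suc n)"] by fastforce
    also have "\<dots> \<le> int (Suc (Suc n) choose 2) * e"
      unfolding e_def by (rule len_Jpow)
    finally show ?thesis unfolding G_def poly2_def by (simp add: mult.commute)
  qed
  moreover have "0 \<le> d n" for n unfolding d_def by (rule len_nonneg)
  moreover have "G (n + 2) - 2 * G (n + 1) + G n = - d n" if "n \<ge> N" for n
    using H2[OF that] unfolding G_def by (simp add: poly2_Suc algebra_simps)
  ultimately obtain N' where N': "N' \<ge> N" "\<And>n. n \<ge> N' \<Longrightarrow> d n = 0"
    using concave_nonneg_eventually_affine[of N G d] by blast
  have "C n = M n" if n: "n \<ge> N'" for n
  proof -
    have nN: "n \<ge> N" using N' n by simp
    \<comment> \<open>\<open>len\<close> says nothing about an infinite length, so finiteness is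
      what turns \<open>d n = 0\<close> into length zero.\<close>
    obtain l where l: "quot_length R (C n) (M n) = enat l" using finC[OF nN] by auto
    then have "quot_length R (C n) (M n) = 0"
      using N'(2)[OF n] unfolding d_def len_def by (simp add: zero_enat_def)
    then show ?thesis using quot_length_eq_0_imp_eq[OF C M MC[OF nN]] by simp
  qed
  then show "\<exists>N'\<ge>N. \<forall>n\<ge>N'. colon R (M (Suc n)) J = M n"
    using N'(1) unfolding C_def by blast
  have "H (n + 2) - 2 * H (n + 1) + H n = e" if "n \<ge> N'" for n
    using H2[of n] N'(1) N'(2)[OF that] that by simp
  from second_diff_const_imp_poly2[OF this]
  show "\<exists>c1 c2. \<forall>\<^sub>F n in sequentially.
      len R (carrier R) (M n) = poly2 (len R (carrier R) J, c1, c2) n"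
    unfolding H_def e_def eventually_sequentially by blast
qed

end

section \<open>The Ratliff-Rush filtration\<close>

locale filtration_pair = parameter_pair +
  fixes F :: "nat \<Rightarrow> 'a set" and K :: "'a set"
  assumes F_ideal: "ideal (F n) R" and F_prod: "F n \<cdot> F k \<subseteq> F (n + k)"
    and F_0: "F 0 = carrier R"
    and F_stable: "\<exists>p. \<forall>n\<ge>p. F 1 \<cdot> F n = F (Suc n)"
    and J_sub: "J \<subseteq> F 1" and J_red: "\<exists>k. J \<cdot> ideal_pow R (F 1) k = ideal_pow R (F 1) (Suc k)"
    and K_ideal: "ideal K R" and F_sub_K: "F (Suc n) \<subseteq> K \<cdot> F n"
begin

abbreviation M :: "nat \<Rightarrow> 'a set" where "M n \<equiv> K \<cdot> F n"
abbreviation Q :: "nat \<Rightarrow> 'a set" where "Q n \<equiv> rr R K F n"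
abbreviation F1pow :: "nat \<Rightarrow> 'a set" where "F1pow k \<equiv> ideal_pow R (F 1) k"

lemma M_ideal: "ideal (M n) R"
  by (intro ideal_prod_is_ideal K_ideal F_ideal)

lemma F1pow_ideal: "ideal (F1pow n) R"
  by (rule ideal_ideal_pow[OF F_ideal])

lemma F1pow_sub: "F1pow n \<subseteq> F n"
proof (induction n)
  case (Suc n)
  have "F1pow n \<cdot> F 1 \<subseteq> F n \<cdot> F 1" using Suc by (rule ideal_prod_mono) simp
  then show ?case using F_prod[of n 1] by simp
qed (simp add: F_0)

lemma Jpow_sub_F: "Jpow n \<subseteq> F n"
  using ideal_pow_mono[OF J_sub, of n] F1pow_sub[of n] by (rule order_trans)

text \<open>The hypothesis \<open>F_sub_K\<close> enters here. It keeps \<lambda>(R/M n) below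
  \<lambda>(R/J^(n+1)), which yields both finiteness and the growth bound.\<close>

lemma Jpow_sub_M: "Jpow (Suc n) \<subseteq> M n"
  using Jpow_sub_F F_sub_K by (rule order_trans)

lemma J_F1pow: "\<exists>k. \<forall>i. J \<cdot> F1pow (k + i) = F1pow (Suc (k + i))"
proof -
  obtain k where k: "J \<cdot> F1pow k = F1pow (Suc k)" using J_red by blast
  have "J \<cdot> F1pow (k + i) = F1pow (Suc (k + i))" for i
  proof (induction i)
    case 0
    show ?case unfolding add_0_right by (rule k)
  next
    case (Suc i)
    have "J \<cdot> F1pow (k + Suc i) = (J \<cdot> F1pow (k + i)) \<cdot> F 1"
      by (simp only: add_Suc_right ideal_pow_Suc ideal_prod_assoc[OF J_ideal F1pow_ideal F_ideal])
    also have "\<dots> = F1pow (Suc (k + Suc i))"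
      unfolding Suc by (simp only: add_Suc_right ideal_pow_Suc)
    finally show ?case .
  qed
  then show ?thesis by blast
qed

text \<open>Beyond \<open>p\<close> the filtration is
  \<open>F (p + j) = F1pow j \<cdot> F p\<close>, so the reduction equation for powers of
  \<open>F 1\<close> transfers to \<open>F\<close>, whose members need not be such powers.\<close>

lemma F_J_stable: "\<exists>N. \<forall>n\<ge>N. F (Suc n) = J \<cdot> F n"
proof -
  obtain p where p: "\<And>n. n \<ge> p \<Longrightarrow> F 1 \<cdot> F n = F (Suc n)" using F_stable by blast
  obtain k where red: "\<And>i. J \<cdot> F1pow (k + i) = F1pow (Suc (k + i))"
    using J_F1pow by blast
  have F: "F (p + j) = F1pow j \<cdot> F p" for j
  proof (induction j)
    case 0
    then show ?case
      using ideal_prod_commute[OF oneideal F_ideal] ideal_prod_one[OF F_ideal] by simp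
  next
    case (Suc j)
    have "F (p + Suc j) = F 1 \<cdot> (F1pow j \<cdot> F p)" using p[of "p + j"] Suc by simp
    also have "\<dots> = F1pow (Suc j) \<cdot> F p"
      by (simp only: ideal_pow_Suc_left[OF F_ideal] ideal_prod_assoc[OF F_ideal F1pow_ideal F_ideal])
    finally show ?case .
  qed
  have "F (Suc n) = J \<cdot> F n" if n: "n \<ge> p + k" for n
  proof -
    obtain i where i: "n = p + (k + i)" using n le_Suc_ex by (metis add.assoc)
    have "J \<cdot> F n = (J \<cdot> F1pow (k + i)) \<cdot> F p"
      unfolding i F by (rule ideal_prod_assoc[OF J_ideal F1pow_ideal F_ideal, symmetric])
    also have "\<dots> = F (p + Suc (k + i))" unfolding red F ..
    finally show ?thesis using i by simp
  qed
  then show ?thesis by blast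
qed

lemma M_J_stable: "\<exists>N. \<forall>n\<ge>N. M (Suc n) = J \<cdot> M n"
proof -
  obtain N where N: "\<And>n. n \<ge> N \<Longrightarrow> F (Suc n) = J \<cdot> F n" using F_J_stable by blast
  have "K \<cdot> (J \<cdot> F n) = J \<cdot> (K \<cdot> F n)" for n
    using ideal_prod_assoc[OF K_ideal J_ideal F_ideal[of n]]
      ideal_prod_assoc[OF J_ideal K_ideal F_ideal[of n]] ideal_prod_commute[OF K_ideal J_ideal]
    by simp
  then show ?thesis using N by (intro exI[of _ N]) simp
qed

section \<open>Colon ideals and the Ratliff-Rush closure\<close>

lemma M_mult:
  assumes "a \<in> M n" "f \<in> F 1"
  shows "a \<otimes> f \<in> M (Suc n)"
proof -
  have "M n \<cdot> F 1 = K \<cdot> (F n \<cdot> F 1)" by (rule ideal_prod_assoc[OF K_ideal F_ideal F_ideal])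
  also have "\<dots> \<subseteq> M (Suc n)" using F_prod[of n 1] by (intro ideal_prod_mono) auto
  finally show ?thesis using assms by (auto intro: ideal_prod.prod)
qed

text \<open>One more factor of \<open>F 1\<close> raises the index of \<open>M\<close> by one. The
  union defining \<open>rr\<close> is therefore increasing, and finitely many of its elements share
  an exponent.\<close>

lemma colon_F1pow_mono:
  assumes r: "r \<in> colon R (M (n + k)) (F1pow k)" and "k \<le> l"
  shows "r \<in> colon R (M (n + l)) (F1pow l)"
  using assms(2)
proof (induction l rule: dec_induct)
  case base
  then show ?case by (fact r)
next
  case (step l)
  then have rc: "r \<in> carrier R" and rl: "\<And>b. b \<in> F1pow l \<Longrightarrow> r \<otimes> b \<in> M (n + l)"
    unfolding colon_def by auto
  interpret M': ideal "M (n + Suc l)" R by (rule M_ideal)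
  have "r \<otimes> b \<in> M (n + Suc l)" if "b \<in> F1pow l \<cdot> F 1" for b
    using that
  proof induction
    case (prod c f)
    have "c \<in> carrier R" "f \<in> carrier R"
      using ideal.Icarr[OF F1pow_ideal prod(1)] ideal.Icarr[OF F_ideal prod(2)] by auto
    then show ?case using M_mult[OF rl[OF prod(1)] prod(2)] rc by (simp add: m_assoc)
  next
    case (sum b c)
    have "F1pow l \<cdot> F 1 \<subseteq> carrier R" by (rule ideal_prod_in_carrier[OF F1pow_ideal F_ideal])
    then have "b \<in> carrier R" "c \<in> carrier R" using sum(1,2) by auto
    then show ?case using M'.a_closed[OF sum(3,4)] rc by (simp add: r_distr)
  qed
  then show ?case using rc unfolding colon_def by simp
qed

text \<open>The union in \<open>rr\<close> starts at 1; monotonicity admits k = 0 as well, and that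
  case shows that \<open>M n\<close> lies in \<open>Q n\<close>.\<close>

lemma mem_rr_iff: "r \<in> Q n \<longleftrightarrow> (\<exists>k. r \<in> colon R (M (n + k)) (F1pow k))"
proof
  assume "\<exists>k. r \<in> colon R (M (n + k)) (F1pow k)"
  then obtain k where "r \<in> colon R (M (n + k)) (F1pow k)" by blast
  then have "r \<in> colon R (M (n + Suc k)) (F1pow (Suc k))" by (rule colon_F1pow_mono) simp
  then show "r \<in> Q n" unfolding rr_def by (intro UN_I[of "Suc k"]) auto
qed (auto simp: rr_def)

lemma rr_ideal: "ideal (Q n) R"
proof (rule cring_idealI)
  have C: "ideal (colon R (M (n + k)) (F1pow k)) R" for k
    using ideal.Icarr[OF F1pow_ideal] by (intro ideal_colon M_ideal subsetI)
  show "Q n \<subseteq> carrier R" unfolding rr_def colon_def by auto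
  show "\<zero> \<in> Q n"
    using additive_subgroup.zero_closed[OF ideal.axioms(1)[OF C]] mem_rr_iff by blast
  show "r \<otimes> a \<in> Q n" if "r \<in> carrier R" "a \<in> Q n" for r a
    using that ideal.I_l_closed[OF C] unfolding mem_rr_iff by blast
  show "a \<oplus> b \<in> Q n" if ab: "a \<in> Q n" "b \<in> Q n" for a b
  proof -
    obtain k l where kl: "a \<in> colon R (M (n + k)) (F1pow k)" "b \<in> colon R (M (n + l)) (F1pow l)"
      using ab unfolding mem_rr_iff by blast
    have "a \<oplus> b \<in> colon R (M (n + max k l)) (F1pow (max k l))"
      by (rule additive_subgroup.a_closed[OF ideal.axioms(1)[OF C]])
        (rule colon_F1pow_mono[OF kl(1)], simp, rule colon_F1pow_mono[OF kl(2)], simp)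
    then show ?thesis unfolding mem_rr_iff by blast
  qed
qed

lemma M_sub_rr: "M n \<subseteq> Q n"
proof
  fix r assume r: "r \<in> M n"
  interpret Mn: ideal "M n" R by (rule M_ideal)
  have "r \<in> colon R (M (n + 0)) (F1pow 0)"
    using r Mn.Icarr Mn.I_r_closed unfolding colon_def ideal_pow_0 by simp
  then show "r \<in> Q n" unfolding mem_rr_iff by blast
qed

lemma finite_colength_rr: "quot_length R (carrier R) (Q n) \<noteq> \<infinity>"
  by (rule finite_colength[OF rr_ideal order_trans[OF Jpow_sub_M M_sub_rr]])

text \<open>For large k the equation \<open>F1pow (Suc k) = J \<cdot> F1pow k\<close> turns the
  conditions on ux and uy with exponent k into one on u with exponent k + 1; the indices agree
  because (n + 1) + k = n + (k + 1). The converse only uses that J lies in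
  \<open>F 1\<close>.\<close>

lemma rr_colon_J: "colon R (Q (Suc n)) J = Q n"
proof
  show "colon R (Q (Suc n)) J \<subseteq> Q n"
  proof
    fix u assume "u \<in> colon R (Q (Suc n)) J"
    then have u: "u \<in> carrier R" "\<And>b. b \<in> J \<Longrightarrow> u \<otimes> b \<in> Q (Suc n)" unfolding colon_def by auto
    obtain k0 where red: "\<And>i. J \<cdot> F1pow (k0 + i) = F1pow (Suc (k0 + i))"
      using J_F1pow by blast
    obtain k1 where k1: "u \<otimes> x \<in> colon R (M (Suc n + k1)) (F1pow k1)"
      using u(2)[OF x_mem] unfolding mem_rr_iff by blast
    obtain k2 where k2: "u \<otimes> y \<in> colon R (M (Suc n + k2)) (F1pow k2)"
      using u(2)[OF y_mem] unfolding mem_rr_iff by blast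
    \<comment> \<open>\<open>k0\<close> serves the reduction equation, \<open>k1\<close> and
      \<open>k2\<close> serve ux and uy; by monotonicity their sum serves all three.\<close>
    define k where "k = k0 + k1 + k2"
    have xk: "u \<otimes> x \<otimes> c \<in> M (Suc n + k)" if "c \<in> F1pow k" for c
      using colon_F1pow_mono[OF k1, of k] that unfolding k_def colon_def by simp
    have yk: "u \<otimes> y \<otimes> c \<in> M (Suc n + k)" if "c \<in> F1pow k" for c
      using colon_F1pow_mono[OF k2, of k] that unfolding k_def colon_def by simp
    interpret M': ideal "M (n + Suc k)" R by (rule M_ideal)
    have "u \<otimes> b \<in> M (n + Suc k)" if b: "b \<in> F1pow (Suc k)" for b
    proof -
      have "b \<in> J \<cdot> F1pow k" using b red[of "k1 + k2"] unfolding k_def by (simp only: add.assoc)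
      then obtain p q where pq: "p \<in> F1pow k" "q \<in> F1pow k" "b = p \<otimes> x \<oplus> q \<otimes> y"
        unfolding mem_Idl_pair_prod_iff[OF x_carr y_carr F1pow_ideal] by blast
      have "u \<otimes> b = u \<otimes> x \<otimes> p \<oplus> u \<otimes> y \<otimes> q"
        unfolding pq(3)
        using u(1) x_carr y_carr ideal.Icarr[OF F1pow_ideal pq(1)] ideal.Icarr[OF F1pow_ideal pq(2)]
        by algebra
      moreover have "u \<otimes> x \<otimes> p \<in> M (n + Suc k)" "u \<otimes> y \<otimes> q \<in> M (n + Suc k)"
        using xk[OF pq(1)] yk[OF pq(2)] by simp_all
      ultimately show ?thesis by (simp only: M'.a_closed)
    qed
    then have "u \<in> colon R (M (n + Suc k)) (F1pow (Suc k))" using u(1) unfolding colon_def by blast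
    then show "u \<in> Q n" unfolding mem_rr_iff by blast
  qed
  show "Q n \<subseteq> colon R (Q (Suc n)) J"
  proof
    fix u assume "u \<in> Q n"
    then obtain k where k: "u \<in> colon R (M (n + k)) (F1pow k)" unfolding mem_rr_iff by blast
    then have u: "u \<in> carrier R" "\<And>b. b \<in> F1pow k \<Longrightarrow> u \<otimes> b \<in> M (n + k)" unfolding colon_def by auto
    have "u \<otimes> z \<in> Q (Suc n)" if z: "z \<in> J" for z
    proof -
      have zc: "z \<in> carrier R" using z J_subset by auto
      have "u \<otimes> z \<otimes> b \<in> M (Suc n + k)" if b: "b \<in> F1pow k" for b
      proof -
        have "u \<otimes> z \<otimes> b = (u \<otimes> b) \<otimes> z"
          using u(1) zc ideal.Icarr[OF F1pow_ideal b] by algebra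
        then show ?thesis using M_mult[OF u(2)[OF b]] z J_sub by auto
      qed
      then have "u \<otimes> z \<in> colon R (M (Suc n + k)) (F1pow k)"
        using u(1) zc unfolding colon_def by simp
      then show ?thesis unfolding mem_rr_iff by blast
    qed
    then show "u \<in> colon R (Q (Suc n)) J" using u(1) unfolding colon_def by simp
  qed
qed

lemma J_rr_sub: "J \<cdot> Q n \<subseteq> Q (Suc n)"
proof (rule ideal_prod_subsetI[OF rr_ideal])
  fix a b assume a: "a \<in> J" and b: "b \<in> Q n"
  then have "b \<otimes> a \<in> Q (Suc n)" using rr_colon_J[of n] unfolding colon_def by auto
  then show "a \<otimes> b \<in> Q (Suc n)"
    using m_comm[of a b] a J_subset ideal.Icarr[OF rr_ideal b] by auto
qed

text \<open>Since J lies in \<open>F 1\<close>, an element r of \<open>Q n\<close> satisfies r J^k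
  \<subseteq> M (n + k) for some k. The eventual equality (M (n + 1) : J) = M n removes the factors
  J one at a time, and its threshold does not depend on k.\<close>

lemma rr_eventually_eq: "\<exists>N. \<forall>n\<ge>N. Q n = M n"
proof -
  obtain N0 where N0: "\<And>n. n \<ge> N0 \<Longrightarrow> M (Suc n) = J \<cdot> M n" using M_J_stable by blast
  obtain N where N: "\<And>n. n \<ge> N \<Longrightarrow> colon R (M (Suc n)) J = M n"
    using eventually_colon_eq[of M N0, OF M_ideal N0 Jpow_sub_M] by blast
  have Jcolon: "r \<in> M n"
    if "n \<ge> N" "r \<in> carrier R" "\<And>b. b \<in> Jpow k \<Longrightarrow> r \<otimes> b \<in> M (n + k)" for n k r
    using that(3)
  proof (induction k)
    case 0
    then show ?case using that(2) 0[of \<one>] by (simp add: ideal_pow_0)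
  next
    case (Suc k)
    show ?case
    proof (rule Suc.IH)
      fix b assume b: "b \<in> Jpow k"
      then have bc: "b \<in> carrier R" using ideal.Icarr[OF Jpow_ideal] by blast
      have "r \<otimes> b \<otimes> z \<in> M (Suc (n + k))" if z: "z \<in> J" for z
      proof -
        have "b \<otimes> z \<in> Jpow (Suc k)" unfolding ideal_pow_Suc using b z by (rule ideal_prod.prod)
        then show ?thesis using Suc.prems[of "b \<otimes> z"] that(1) z J_subset bc \<open>r \<in> carrier R\<close>
          by (auto simp: m_assoc)
      qed
      then have "r \<otimes> b \<in> colon R (M (Suc (n + k))) J"
        using bc \<open>r \<in> carrier R\<close> unfolding colon_def by simp
      then show "r \<otimes> b \<in> M (n + k)" using N[of "n + k"] \<open>n \<ge> N\<close> by simp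
    qed
  qed
  have "Q n \<subseteq> M n" if n: "n \<ge> N" for n
  proof
    fix r assume "r \<in> Q n"
    then obtain k where "r \<in> colon R (M (n + k)) (F1pow k)" unfolding mem_rr_iff by blast
    then have "r \<in> carrier R" "\<And>b. b \<in> Jpow k \<Longrightarrow> r \<otimes> b \<in> M (n + k)"
      using ideal_pow_mono[OF J_sub, of k] unfolding colon_def by auto
    then show "r \<in> M n" by (rule Jcolon[OF n])
  qed
  then show ?thesis using M_sub_rr by blast
qed

text \<open>The growth argument applies to \<open>F\<close> itself with the same J. Hence e_0 and
  g_0 are both \<lambda>(R/J), which lets e_0 cancel in the formula for g_1.\<close>

lemma hilbert_coeffs_fst: "fst (hilbert_coeffs R F) = len R (carrier R) J"
proof -
  obtain N where N: "\<And>n. n \<ge> N \<Longrightarrow> F (Suc n) = J \<cdot> F n" using F_J_stable by blast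
  have "Jpow (Suc n) \<subseteq> F n" for n
    by (rule order_trans[OF ideal_pow_Suc_subset[OF J_ideal] Jpow_sub_F])
  then obtain c1 c2 where
    "\<forall>\<^sub>F n in sequentially. len R (carrier R) (F n) = poly2 (len R (carrier R) J, c1, c2) n"
    using eventually_len_poly2[of F N, OF F_ideal N] by blast
  then show ?thesis unfolding hilbert_coeffs_def by (simp add: poly2_coeffs_eqI)
qed

lemma fiber_coeffs_poly2:
  shows "fst (fiber_coeffs R K F) = len R (carrier R) J"
    and "\<forall>\<^sub>F n in sequentially. len R (carrier R) (M n) = poly2 (fiber_coeffs R K F) n"
proof -
  obtain N where N: "\<And>n. n \<ge> N \<Longrightarrow> M (Suc n) = J \<cdot> M n" using M_J_stable by blast
  obtain c1 c2 where c:
    "\<forall>\<^sub>F n in sequentially. len R (carrier R) (M n) = poly2 (len R (carrier R) J, c1, c2) n"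
    using eventually_len_poly2[of M N, OF M_ideal N Jpow_sub_M] by blast
  then have "fiber_coeffs R K F = (len R (carrier R) J, c1, c2)"
    unfolding fiber_coeffs_def by (rule poly2_coeffs_eqI)
  then show "fst (fiber_coeffs R K F) = len R (carrier R) J"
    and "\<forall>\<^sub>F n in sequentially. len R (carrier R) (M n) = poly2 (fiber_coeffs R K F) n"
    using c by simp_all
qed

lemma len_rr_J_rr:
  shows "quot_length R (Q (n + 2)) (J \<cdot> Q (n + 1)) \<noteq> \<infinity>"
    and "len R (Q (n + 2)) (J \<cdot> Q (n + 1)) = len R (carrier R) J
      - (len R (carrier R) (Q (n + 2)) - 2 * len R (carrier R) (Q (n + 1)) + len R (carrier R) (Q n))"
proof -
  note l = len_J_prod[OF rr_ideal finite_colength_rr, of "n + 1"]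
  have sub: "J \<cdot> Q (n + 1) \<subseteq> Q (n + 2)" using J_rr_sub[of "n + 1"] by simp
  have "Q (n + 2) \<subseteq> carrier R" using ideal.Icarr[OF rr_ideal] by blast
  note a = len_add[OF oneideal ideal_prod_is_ideal[OF J_ideal rr_ideal] rr_ideal sub this l(1)]
  show "quot_length R (Q (n + 2)) (J \<cdot> Q (n + 1)) \<noteq> \<infinity>" by (rule a(3))
  show "len R (Q (n + 2)) (J \<cdot> Q (n + 1)) = len R (carrier R) J
      - (len R (carrier R) (Q (n + 2)) - 2 * len R (carrier R) (Q (n + 1)) + len R (carrier R) (Q n))"
    using a(1) l(2) rr_colon_J[of n] by simp
qed

theorem rr_fiber_coeffs:
  assumes "fiber_coeffs R K F = (g0, g1, g2)"
  shows "(\<forall>n. quot_length R (carrier R) (rr R K F n) \<noteq> \<infinity>) \<and>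
    (\<forall>n\<ge>2. quot_length R (rr R K F n) (J \<cdot> rr R K F (n - 1)) \<noteq> \<infinity>) \<and>
    (\<forall>\<^sub>F n in sequentially. len R (carrier R) (rr R K F n) = poly2 (g0, g1, g2) n) \<and>
    (\<forall>n\<ge>2. (backward_diff ^^ 2) (\<lambda>i. poly2 (g0, g1, g2) i - len R (carrier R) (rr R K F i)) n
             = len R (rr R K F n) (J \<cdot> rr R K F (n - 1))) \<and>
    finite {n. vseq R K F J n \<noteq> 0} \<and>
    g1 = (\<Sum>n | 1 \<le> n \<and> vseq R K F J n \<noteq> 0. vseq R K F J n)
           - len R (carrier R) (rr R K F 0) \<and>
    g2 = (\<Sum>n | 1 \<le> n \<and> vseq R K F J n \<noteq> 0. (int n - 1) * vseq R K F J n)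
           + len R (carrier R) (rr R K F 0)"
proof -
  define e where "e = len R (carrier R) J"
  define h where "h n = len R (carrier R) (Q n)" for n
  \<comment> \<open>The error \<open>w\<close> is eventually zero. The second difference of the
    polynomial is g_0, so that of \<open>w\<close> is g_0 minus the second difference of
    \<open>h\<close>.\<close>
  define w where "w n = poly2 (g0, g1, g2) n - h n" for n
  define v where "v = vseq R K F J"
  have g0: "g0 = e" using fiber_coeffs_poly2(1) assms unfolding e_def by simp
  obtain e1 e2 where e0: "hilbert_coeffs R F = (e, e1, e2)"
    using hilbert_coeffs_fst unfolding e_def by (metis prod.collapse)
  obtain N where N: "\<And>n. n \<ge> N \<Longrightarrow> Q n = M n" using rr_eventually_eq by blast
  have "\<forall>\<^sub>F n in sequentially. Q n = M n" using N by (auto simp: eventually_sequentially)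
  with fiber_coeffs_poly2(2)
  have ev: "\<forall>\<^sub>F n in sequentially. h n = poly2 (g0, g1, g2) n"
    unfolding h_def by eventually_elim (simp add: assms)
  have v_ge2: "v n = len R (Q n) (J \<cdot> Q (n - 1))" if "n \<ge> 2" for n
    using that unfolding v_def vseq_def e0 by simp
  \<comment> \<open>This is \<open>e\<close> minus the second difference of \<open>h\<close> at 1,
    with the value of \<open>h\<close> at -1 read as 0.\<close>
  have v_1: "v 1 = e - h 1 + 2 * h 0"
    unfolding v_def vseq_def e0 h_def by simp
  have w2: "w (n + 2) - 2 * w (n + 1) + w n = len R (Q (n + 2)) (J \<cdot> Q (n + 1))" for n
    using len_rr_J_rr(2)[of n] unfolding w_def g0 e_def[symmetric] h_def[symmetric]
    by (simp add: poly2_Suc algebra_simps)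
  have v_w: "v n = w n - 2 * w (n - 1) + w (n - 2)" if n: "n \<ge> 2" for n
  proof -
    obtain k where "n = k + 2" using n le_Suc_ex by (metis add.commute)
    then show ?thesis using w2[of k] v_ge2[OF n] by simp
  qed
  have diff: "(backward_diff ^^ 2) w n = v n" if n: "n \<ge> 2" for n
    using v_w[OF n] by (simp add: backward_diff_def numeral_2_eq_2)
  obtain N' where N': "\<And>n. n \<ge> N' \<Longrightarrow> w n = 0"
    using ev unfolding w_def eventually_sequentially by fastforce
  note sums = second_diff_finite_sums[of N' w v, OF N' v_w]
  have w01: "w 0 = g2 - h 0" "w 1 = e - g1 + g2 - h 1"
    unfolding w_def g0 by (simp_all add: poly2_def numeral_2_eq_2)
  have fin2: "quot_length R (Q n) (J \<cdot> Q (n - 1)) \<noteq> \<infinity>" if n: "n \<ge> 2" for n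
  proof -
    obtain k where "n = k + 2" using n le_Suc_ex by (metis add.commute)
    then show ?thesis using len_rr_J_rr(1)[of k] by simp
  qed
  \<comment> \<open>The two sums are \<open>v 1 + w 0 - w 1 = g1 + h 0\<close> and
    \<open>w 0 = g2 - h 0\<close>, whence the opposite signs of \<open>h 0\<close>.\<close>
  have g: "g1 = (\<Sum>n | 1 \<le> n \<and> v n \<noteq> 0. v n) - h 0"
    "g2 = (\<Sum>n | 1 \<le> n \<and> v n \<noteq> 0. (int n - 1) * v n) + h 0"
    using sums(2,3) v_1 w01 by linarith+
  have diff': "\<forall>n\<ge>2. (backward_diff ^^ 2) (\<lambda>i. poly2 (g0, g1, g2) i - h i) n
      = len R (Q n) (J \<cdot> Q (n - 1))"
    using diff v_ge2 unfolding w_def by simp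
  show ?thesis
    using finite_colength_rr fin2 ev diff' sums(1) g unfolding v_def h_def by blast
qed

end

(* The source prints "- lambda(R/rr_K(I_0))" in the formula for g2. With the stated conventions that
   is a sign error (R = k[[x,y]], K = m, I_n = m^n has g2 = 1, v_n = 0 for all n and
   lambda(R/rr_K(I_0)) = 1); the sign is "+" below. *)

theorem proposition2p5:
  fixes R :: "('a, 'b) ring_scheme" and m K J :: "'a set" and F :: "nat \<Rightarrow> 'a set"
    and x y :: 'a and g0 g1 g2 :: int
  assumes "cohen_macaulay_local_ring R m" and "krull_dim R = 2"
    and "hilbert_filtration R m F"
    and "ideal K R" and "\<And>n. F (n + 1) \<subseteq> K \<cdot>\<^bsub>R\<^esub> F n"
    and "x \<in> carrier R" and "y \<in> carrier R" and "J = Idl\<^bsub>R\<^esub> {x, y}"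
    and "minimal_reduction R J (F 1)"
    and "fiber_coeffs R K F = (g0, g1, g2)"
  shows "(\<forall>n. quot_length R (carrier R) (rr R K F n) \<noteq> \<infinity>) \<and>
    (\<forall>n\<ge>2. quot_length R (rr R K F n) (J \<cdot>\<^bsub>R\<^esub> rr R K F (n - 1)) \<noteq> \<infinity>) \<and>
    (\<forall>\<^sub>F n in sequentially. len R (carrier R) (rr R K F n) = poly2 (g0, g1, g2) n) \<and>
    (\<forall>n\<ge>2. (backward_diff ^^ 2) (\<lambda>i. poly2 (g0, g1, g2) i - len R (carrier R) (rr R K F i)) n
             = len R (rr R K F n) (J \<cdot>\<^bsub>R\<^esub> rr R K F (n - 1))) \<and>
    finite {n. vseq R K F J n \<noteq> 0} \<and>
    g1 = (\<Sum>n | 1 \<le> n \<and> vseq R K F J n \<noteq> 0. vseq R K F J n)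
           - len R (carrier R) (rr R K F 0) \<and>
    g2 = (\<Sum>n | 1 \<le> n \<and> vseq R K F J n \<noteq> 0. (int n - 1) * vseq R K F J n)
           + len R (carrier R) (rr R K F 0)"
proof -
  have R: "cring R" "noetherian_ring R" "maximalideal m R"
    using assms(1) unfolding cohen_macaulay_local_ring_def noetherian_local_ring_def by auto
  interpret cring R by (fact R(1))
  have F: "\<And>n. ideal (F n) R" "F 0 = carrier R" "\<And>n k. F n \<cdot>\<^bsub>R\<^esub> F k \<subseteq> F (n + k)"
    "\<exists>p. \<forall>n\<ge>p. F 1 \<cdot>\<^bsub>R\<^esub> F n = F (Suc n)" "radical R (F 1) = m"
    using assms(3) unfolding hilbert_filtration_def primary_to_def by auto
  have FK: "F (Suc n) \<subseteq> K \<cdot>\<^bsub>R\<^esub> F n" for n using assms(5)[of n] by simp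
  have red: "ideal J R" "J \<subseteq> F 1"
    "\<exists>k. J \<cdot>\<^bsub>R\<^esub> ideal_pow R (F 1) k = ideal_pow R (F 1) (Suc k)"
    using assms(9) unfolding minimal_reduction_def reduction_def by auto
  then obtain c where c: "J \<cdot>\<^bsub>R\<^esub> ideal_pow R (F 1) c = ideal_pow R (F 1) (Suc c)" by blast
  \<comment> \<open>A power of \<open>a\<close> lies in \<open>F 1\<close>, and the (c+1)-st power
    of that lies in \<open>F 1\<close> to the c + 1, which is contained in J by the reduction
    equation. This gives the finiteness of \<lambda>(R/J) and also moves powers of a regular
    sequence from \<open>m\<close> into J.\<close>
  have nil: "\<exists>k::nat. a [^]\<^bsub>R\<^esub> k \<in> J" if a: "a \<in> m" for a
  proof -
    obtain k :: nat where k: "a \<in> carrier R" "a [^]\<^bsub>R\<^esub> k \<in> F 1"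
      using a F(5) unfolding radical_def by auto
    have "(a [^]\<^bsub>R\<^esub> k) [^]\<^bsub>R\<^esub> Suc c \<in> J \<cdot>\<^bsub>R\<^esub> ideal_pow R (F 1) c"
      unfolding c by (rule pow_mem_ideal_pow[OF k(2)])
    moreover have "J \<cdot>\<^bsub>R\<^esub> ideal_pow R (F 1) c \<subseteq> J"
      using ideal_prod_inter[OF red(1) ideal_ideal_pow[OF F(1)]] by blast
    ultimately have "a [^]\<^bsub>R\<^esub> (k * Suc c) \<in> J" unfolding nat_pow_pow[OF k(1)] by (rule subsetD[rotated])
    then show ?thesis by blast
  qed
  have "ring_depth R m = 2"
    using assms(1,2) unfolding cohen_macaulay_local_ring_def by simp
  then obtain a b where ab: "a \<in> m" "b \<in> m" "regular_pair a b" by (rule depth_two_regular_pair)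
  obtain k l :: nat where kl: "a [^]\<^bsub>R\<^esub> k \<in> J" "b [^]\<^bsub>R\<^esub> l \<in> J" using nil ab by blast
  have "regular_pair (a [^]\<^bsub>R\<^esub> k) (b [^]\<^bsub>R\<^esub> l)"
    by (intro regular_pair_pow_right regular_pair_pow_left ab(3))
  then have "acyclic_pair R x y"
    using kl assms(6,7) unfolding assms(8) by (intro regular_pair_imp_acyclic_pair)
  moreover have "quot_length R (carrier R) J \<noteq> \<infinity>"
    by (rule noetherian_quot_length_finite[OF R(2,3) red(1) nil])
  ultimately have "parameter_pair R x y"
    unfolding assms(8) by (simp add: parameter_pair_def parameter_pair_axioms_def)
  moreover have "filtration_pair_axioms R x y F K"
    by (rule filtration_pair_axioms.intro[OF F(1,3,2,4) red(2,3)[unfolded assms(8)] assms(4) FK])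
  ultimately interpret filtration_pair R x y F K by (rule filtration_pair.intro)
  show ?thesis unfolding assms(8) by (rule rr_fiber_coeffs[OF assms(10)])
qed

end
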